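(* Assume $\mathbb E[|Y|^2]+\mathbb E[|X|^8]<\infty$ and that the kernel function is rotationally invariant, $K(x)=\mathcal K(|x|_V^2)$, where $\mathcal K',\mathcal K'':\mathbb R_{\ge0}\to\mathbb R$ are bounded continuous functions and $r\mathcal K'(r)$ is bounded for large $r$. Suppose $V=W\oplus W'$ is a direct sum decomposition, with corresponding components $X=(X_W,X_{W'})$, such that $X_W\sim N(\mathbb E[X_W],\mathrm{Cov}(X_W))$ is a Gaussian vector independent of $X_{W'}$, and $\mathbb E[Y|X]$ depends only on $X_{W'}$. Let $\Sigma(t)$ be a solution in $\mathrm{Sym}^2_{\ge0}$ of the Riemannian gradient flow $$\frac{d\Sigma_{ab}}{dt}=-\frac12\left(\Sigma_{ac}C_{bd}(D\mathcal J(\Sigma;\lambda))^{cd}+\Sigma_{bd}C_{ac}(D\mathcal J(\Sigma;\lambda))^{cd}\right).$$ Then for any vector $w\in W$ with $|w|_V=1$, the functional $|w|_{\Sigma(t)}$ decreases in time (i.e. is non-increasing in $t$) along the flow.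
   Context: $V$ is a real $d$-dimensional vector space with dual $V^*$, and $\lambda>0$ is fixed. $X$ is a $V$-valued random variable and $Y$ a complex-valued random variable. The covariance $\mathrm{Cov}(X)(\omega,\omega)=\mathbb E[\langle\omega,X-\mathbb E[X]\rangle^2]$ is an inner product on $V^*$, with matrix $C^{ij}$; the inverse matrix $C_{ij}$ defines the inner product $|\cdot|_V^2=(\cdot,\cdot)_V$ on $V$. Adjoints $U^T$ are taken with respect to $(\cdot,\cdot)_V$. Summation over repeated indices is understood. For a form $\Sigma$, $|w|_\Sigma^2=\Sigma(w,w)$. Kernel: $k_V:V^*\to(0,\infty)$ is rotationally invariant, i.e. a function of the dual norm $|\omega|_V^2$, with $\int_{V^*}k_V\,d\omega=1$, and $K(x)=\int_{V^*}e^{2\pi i\langle x,\omega\rangle}k_V(\omega)d\omega$. $\mathcal H$ is the Hilbert space of functions $f(x)=\int_{V^*}\hat f(\omega)e^{2\pi i\langle\omega,x\rangle}d\omega$ on $V$ with $\|f\|_{\mathcal H}^2=\int_{V^*}|\hat f|^2/k_V\,d\omega<\infty$. For $U\in\mathrm{End}(V)$: $J(U,\lambda)=\inf_{f\in\mathcal H}\{\frac12\mathbb E[|Y-f(UX)|^2]+\frac\lambda2\|f\|_{\mathcal H}^2\}$. $\mathrm{Sym}^2_{\ge0}\subset\mathrm{Sym}^2V^*$ is the set of positive semi-definite forms on $V$. For $\Sigma\in\mathrm{Sym}^2_{\ge0}$, $\mathcal J(\Sigma;\lambda):=J(U,\lambda)$ for any $U$ with $|x|_\Sigma^2=|Ux|_V^2$,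 i.e. $\Sigma=U^TU$ (by rotational invariance this depends only on $\Sigma$). Known background: $\mathcal J$ is $C^1$ on $\mathrm{Sym}^2_{\ge0}$, meaning there is a continuous $D\mathcal J:\mathrm{Sym}^2_{\ge0}\to\mathrm{Sym}^2V$ with $\mathcal J(\Sigma';\lambda)=\mathcal J(\Sigma;\lambda)+\langle D\mathcal J(\Sigma;\lambda),\Sigma'-\Sigma\rangle+o(|\Sigma'-\Sigma|)$ for $\Sigma,\Sigma'\in\mathrm{Sym}^2_{\ge0}$; moreover $D\mathcal J$ extends to a Lipschitz function on $\mathrm{Sym}^2V^*$. The flow in the claim exists for all $t\ge0$ and preserves $\mathrm{Sym}^2_{\ge0}$. *)

theory Defs
  imports "HOL-Probability.Probability"
begin

text \<open>
  The vector space \<open>V\<close> and its dual are both written \<open>real ^ 'n\<close>, in a basis of \<open>V\<close> and the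
  dual basis, so the duality pairing is \<open>\<omega> \<bullet> x\<close>. The standard inner product has no other
  role: the geometry of \<open>V\<close> is the one given by the inverse covariance matrix of \<open>X\<close>.
  A matrix \<open>A\<close> stands for the bilinear form with these coefficients, on \<open>V\<close> or on its dual.
\<close>

definition form_sq :: "real ^ 'n ^ 'n \<Rightarrow> real ^ 'n \<Rightarrow> real" where
  "form_sq A x = x \<bullet> (A *v x)"

definition form_norm :: "real ^ 'n ^ 'n \<Rightarrow> real ^ 'n \<Rightarrow> real" where
  "form_norm A x = sqrt (form_sq A x)"

definition Sym2_nonneg :: "(real ^ 'n ^ 'n) set" where
  "Sym2_nonneg = {S. transpose S = S \<and> (\<forall>x. 0 \<le> form_sq S x)}"

definition covariance :: "'a measure \<Rightarrow> ('a \<Rightarrow> real ^ 'n) \<Rightarrow> real ^ 'n ^ 'n" where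
  "covariance M X = (\<chi> i j. LINT p|M. (X p - integral\<^sup>L M X) $ i * (X p - integral\<^sup>L M X) $ j)"

definition V_form :: "'a measure \<Rightarrow> ('a \<Rightarrow> real ^ 'n) \<Rightarrow> real ^ 'n ^ 'n" where
  "V_form M X = matrix_inv (covariance M X)"

definition kernel_of :: "(real ^ 'n \<Rightarrow> real) \<Rightarrow> real ^ 'n \<Rightarrow> complex" where
  "kernel_of k x = (LINT \<omega>|lborel. exp (2 * of_real pi * \<i> * of_real (x \<bullet> \<omega>)) * of_real (k \<omega>))"

text \<open>
  \<open>fh\<close> is a density with finite weighted norm whose inverse Fourier transform is \<open>f\<close>;
  its integrability follows from that of \<open>k\<close> by the Cauchy-Schwarz inequality.
\<close>

definition fourier_rep ::
  "(real ^ 'n \<Rightarrow> real) \<Rightarrow> (real ^ 'n \<Rightarrow> complex) \<Rightarrow> (real ^ 'n \<Rightarrow> complex) \<Rightarrow> bool" where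
  "fourier_rep k f fh \<longleftrightarrow>
     fh \<in> borel_measurable lborel \<and>
     integrable lborel (\<lambda>\<omega>. (cmod (fh \<omega>))\<^sup>2 / k \<omega>) \<and>
     (\<forall>x. f x = (LINT \<omega>|lborel. fh \<omega> * exp (2 * of_real pi * \<i> * of_real (\<omega> \<bullet> x))))"

definition rkhs :: "(real ^ 'n \<Rightarrow> real) \<Rightarrow> (real ^ 'n \<Rightarrow> complex) set" where
  "rkhs k = {f. \<exists>fh. fourier_rep k f fh}"

text \<open>
  By Fourier uniqueness \<open>fh\<close> is determined by \<open>f\<close> almost everywhere, so for \<open>f\<close> in
  \<open>rkhs k\<close> the infimum is over the one-element set of the squared norm of \<open>f\<close>.
\<close>

definition rkhs_norm_sq :: "(real ^ 'n \<Rightarrow> real) \<Rightarrow> (real ^ 'n \<Rightarrow> complex) \<Rightarrow> real" where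
  "rkhs_norm_sq k f = (INF fh\<in>{fh. fourier_rep k f fh}. LINT \<omega>|lborel. (cmod (fh \<omega>))\<^sup>2 / k \<omega>)"

definition J_lin ::
  "'a measure \<Rightarrow> ('a \<Rightarrow> real ^ 'n) \<Rightarrow> ('a \<Rightarrow> complex) \<Rightarrow> (real ^ 'n \<Rightarrow> real) \<Rightarrow> real
    \<Rightarrow> real ^ 'n ^ 'n \<Rightarrow> real" where
  "J_lin M X Y k lam U =
     (INF f\<in>rkhs k. 1 / 2 * (LINT p|M. (cmod (Y p - f (U *v X p)))\<^sup>2) + lam / 2 * rkhs_norm_sq k f)"

text \<open>For rotationally invariant \<open>k\<close> the value does not depend on the choice of \<open>U\<close>.\<close>

definition J_form ::
  "'a measure \<Rightarrow> ('a \<Rightarrow> real ^ 'n) \<Rightarrow> ('a \<Rightarrow> complex) \<Rightarrow> (real ^ 'n \<Rightarrow> real) \<Rightarrow> real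
    \<Rightarrow> real ^ 'n ^ 'n \<Rightarrow> real" where
  "J_form M X Y k lam S =
     J_lin M X Y k lam (SOME U. \<forall>x. form_sq S x = form_sq (V_form M X) (U *v x))"

text \<open>
  \<open>D\<close> is the continuous derivative, with values in the symmetric square of \<open>V\<close>, of a \<open>C\<^sup>1\<close>
  function on the positive semi-definite forms. It is unique on them, since they span the
  space of symmetric forms.
\<close>

definition C1_derivative_on_Sym2_nonneg ::
  "(real ^ 'n ^ 'n \<Rightarrow> real) \<Rightarrow> (real ^ 'n ^ 'n \<Rightarrow> real ^ 'n ^ 'n) \<Rightarrow> bool" where
  "C1_derivative_on_Sym2_nonneg F D \<longleftrightarrow>
     continuous_on Sym2_nonneg D \<and>
     (\<forall>S\<in>Sym2_nonneg. transpose (D S) = D S \<and>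
        (F has_derivative (\<lambda>H. \<Sum>c\<in>UNIV. \<Sum>d\<in>UNIV. D S $ c $ d * H $ c $ d))
          (at S within Sym2_nonneg))"

definition flow_field ::
  "real ^ 'n ^ 'n \<Rightarrow> (real ^ 'n ^ 'n \<Rightarrow> real ^ 'n ^ 'n) \<Rightarrow> real ^ 'n ^ 'n \<Rightarrow> real ^ 'n ^ 'n" where
  "flow_field G D S = (\<chi> a b. - (1 / 2) *
     ((\<Sum>c\<in>UNIV. \<Sum>d\<in>UNIV. S $ a $ c * G $ b $ d * D S $ c $ d) +
      (\<Sum>c\<in>UNIV. \<Sum>d\<in>UNIV. S $ b $ d * G $ a $ c * D S $ c $ d)))"

definition direct_sum_decomp :: "(real ^ 'n) set \<Rightarrow> (real ^ 'n) set \<Rightarrow> bool" where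
  "direct_sum_decomp W W' \<longleftrightarrow>
     subspace W \<and> subspace W' \<and> W \<inter> W' = {0} \<and> (\<forall>x. \<exists>u\<in>W. \<exists>v\<in>W'. x = u + v)"

definition component :: "(real ^ 'n) set \<Rightarrow> (real ^ 'n) set \<Rightarrow> real ^ 'n \<Rightarrow> real ^ 'n" where
  "component W W' x = (THE u. u \<in> W \<and> x - u \<in> W')"

text \<open>
  A random vector is Gaussian if all its linear functionals are Gaussian. The degenerate case,
  a constant functional, is needed because a vector with values in a proper subspace of \<open>V\<close>
  is regarded as \<open>V\<close>-valued.
\<close>

definition gaussian_vector ::
  "'a measure \<Rightarrow> ('a \<Rightarrow> real ^ 'n) \<Rightarrow> real ^ 'n \<Rightarrow> real ^ 'n ^ 'n \<Rightarrow> bool" where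
  "gaussian_vector M Z m Q \<longleftrightarrow>
     Z \<in> borel_measurable M \<and>
     (\<forall>\<omega>. if form_sq Q \<omega> = 0 then (AE p in M. \<omega> \<bullet> Z p = \<omega> \<bullet> m)
          else distributed M lborel (\<lambda>p. \<omega> \<bullet> Z p) (normal_density (\<omega> \<bullet> m) (form_norm Q \<omega>)))"

definition complex_cond_exp :: "'a measure \<Rightarrow> 'a measure \<Rightarrow> ('a \<Rightarrow> complex) \<Rightarrow> 'a \<Rightarrow> complex" where
  "complex_cond_exp M F Y p =
     Complex (real_cond_exp M F (\<lambda>q. Re (Y q)) p) (real_cond_exp M F (\<lambda>q. Im (Y q)) p)"

end

theory Submission imports Defs begin

text \<open>
  Put \<open>\<theta> = G w\<close>, where \<open>G\<close> is the inverse covariance. Along the flow the derivative of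
  \<open>\<Sigma>(w, w)\<close> is \<open>- \<langle>DJ(\<Sigma>), \<Sigma>w \<otimes> \<theta>\<rangle>\<close>, and \<open>2 \<langle>DJ(\<Sigma>), \<Sigma>w \<otimes> \<theta>\<rangle>\<close> is the
  derivative at \<open>s = 0\<close> of the objective along the curve that replaces \<open>X\<close> by
  \<open>X + s \<langle>\<theta>, X\<rangle> w\<close>. So it suffices that the objective does not increase when \<open>s\<close> moves
  from \<open>0\<close> into \<open>[-1, 0]\<close>. There the Gaussian coordinate \<open>\<langle>\<theta>, X\<rangle>\<close>, which is independent
  of everything relevant to \<open>Y\<close>, is shrunk by the factor \<open>1 + s\<close>, and the original \<open>X\<close> is
  recovered in law by adding independent Gaussian noise in the direction \<open>w\<close>. Averaging a
  competitor over this noise multiplies its Fourier transform by a characteristic function, so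
  its norm does not grow, and by Jensen's inequality its loss does not grow either.

  Competitors are Fourier integrals, so their losses only involve expectations of plane waves;
  one-dimensional Gaussian characteristic functions therefore suffice, and no
  multivariate uniqueness theorem is needed.
\<close>

section \<open>Positive semi-definite forms and isometries\<close>

lemma inner_matrix_vector_transpose:
  fixes A :: "real ^ 'm ^ 'n"
  shows "x \<bullet> (A *v y) = (transpose A *v x) \<bullet> y"
  by (simp add: dot_lmul_matrix)

lemma symmetric_matrix_inner_commute:
  fixes S :: "real ^ 'n ^ 'n"
  assumes "transpose S = S"
  shows "x \<bullet> (S *v y) = y \<bullet> (S *v x)"
  using inner_matrix_vector_transpose[of x S y] unfolding assms by (simp add: inner_commute)

lemma form_sq_add_scaleR:
  assumes "transpose S = S"
  shows "form_sq S (x + t *\<^sub>R y) = form_sq S x + 2 * t * (x \<bullet> (S *v y)) + t\<^sup>2 * form_sq S y"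
proof -
  have "y \<bullet> (S *v x) = x \<bullet> (S *v y)"
    using assms by (rule symmetric_matrix_inner_commute)
  then show ?thesis
    unfolding form_sq_def
    by (simp add: matrix_vector_right_distrib matrix_vector_mult_scaleR inner_add_left inner_add_right
        algebra_simps power2_eq_square)
qed

text \<open>If \<open>x\<close> is null for the form, the form is affine in \<open>t\<close> along
  \<open>S *v x + t *\<^sub>R x\<close>, with slope twice the squared norm of \<open>S *v x\<close>.
  A nonzero slope would make it negative somewhere.\<close>

lemma Sym2_nonneg_null_vector:
  assumes S: "S \<in> Sym2_nonneg" and "form_sq S x = 0"
  shows "S *v x = 0"
proof (rule ccontr)
  assume "S *v x \<noteq> 0"
  define n where "n = (S *v x) \<bullet> (S *v x)"
  have n: "n > 0" using \<open>S *v x \<noteq> 0\<close> by (simp add: n_def)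
  \<comment> \<open>The point of the line at which the affine function takes the value -1.\<close>
  define t where "t = - (form_sq S (S *v x) + 1) / (2 * n)"
  have "0 \<le> form_sq S ((S *v x) + t *\<^sub>R x)"
    using S by (simp add: Sym2_nonneg_def)
  also have "\<dots> = form_sq S (S *v x) + 2 * t * n"
    using S assms(2) by (subst form_sq_add_scaleR) (auto simp: Sym2_nonneg_def n_def)
  also have "\<dots> = -1" using n by (simp add: t_def field_simps)
  finally show False by simp
qed

lemma Sym2_nonneg_Cauchy_Schwarz:
  assumes S: "S \<in> Sym2_nonneg" and "form_sq S y > 0"
  shows "(x \<bullet> (S *v y))\<^sup>2 / form_sq S y \<le> form_sq S x"
proof -
  define b where "b = x \<bullet> (S *v y)"
  define q where "q = form_sq S y"
  have q: "q > 0" using assms by (simp add: q_def)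
  \<comment> \<open>The coefficient \<open>- b / q\<close> minimises the form along the line through
    \<open>x\<close> in direction \<open>y\<close>.\<close>
  have "0 \<le> form_sq S (x + (- b / q) *\<^sub>R y)"
    using S by (simp add: Sym2_nonneg_def)
  also have "\<dots> = form_sq S x + 2 * (- b / q) * b + (- b / q)\<^sup>2 * q"
    using S by (subst form_sq_add_scaleR) (auto simp: Sym2_nonneg_def b_def q_def)
  also have "\<dots> = form_sq S x - b\<^sup>2 / q"
    using q by (simp add: power2_eq_square)
  finally show ?thesis by (simp add: b_def q_def)
qed

text \<open>Lagrange reduction: as long as the form is nonzero, one splits off the square of a
  linear functional so that the remainder is still nonnegative and has smaller rank. Bounding the
  rank by \<open>card I\<close>, rather than fixing it, leaves the index set free; surplus indices
  get the zero vector.\<close>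

lemma Sym2_nonneg_sum_squares:
  fixes S :: "real ^ 'n ^ 'n" and I :: "'i set"
  assumes "finite I" "S \<in> Sym2_nonneg" "dim (range ((*v) S)) \<le> card I"
  shows "\<exists>v. \<forall>x. form_sq S x = (\<Sum>i\<in>I. (v i \<bullet> x)\<^sup>2)"
  using assms
proof (induction I arbitrary: S rule: finite_induct)
  case empty
  then have "S *v x = 0" for x by auto
  then show ?case by (simp add: form_sq_def)
next
  case (insert j I)
  show ?case
  proof (cases "\<forall>y. S *v y = 0")
    case True
    then show ?thesis by (intro exI[of _ "\<lambda>_. 0"]) (simp add: form_sq_def)
  next
    case False
    then obtain y where y: "S *v y \<noteq> 0" by blast
    define q where "q = form_sq S y"
    \<comment> \<open>The subtracted form is the one that Cauchy-Schwarz bounds by \<open>S\<close>,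
      so the remainder stays nonnegative.\<close>
    define S' where "S' = S - (1 / q) *\<^sub>R (\<chi> a b. (S *v y) $ a * (S *v y) $ b)"
    have q: "q > 0"
      using Sym2_nonneg_null_vector[OF insert.prems(1), of y] y insert.prems(1)
      by (force simp: q_def Sym2_nonneg_def order_less_le)
    have S'v: "S' *v x = S *v x - ((x \<bullet> (S *v y)) / q) *\<^sub>R (S *v y)" for x
      by (simp add: S'_def matrix_vector_mult_diff_rdistrib scaleR_matrix_vector_assoc[symmetric])
        (simp add: vec_eq_iff matrix_vector_mult_def inner_vec_def sum_distrib_left sum_distrib_right sum_divide_distrib ac_simps)
    have form: "form_sq S x = (x \<bullet> (S *v y))\<^sup>2 / q + form_sq S' x" for x
      by (simp add: form_sq_def S'v inner_diff_right power2_eq_square)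
    have "transpose S' = S'"
      using insert.prems(1)
      by (simp add: S'_def Sym2_nonneg_def transpose_def vec_eq_iff mult.commute)
    moreover have "0 \<le> form_sq S' x" for x
      using form[of x] Sym2_nonneg_Cauchy_Schwarz[OF insert.prems(1), of y x] q by (simp add: q_def)
    ultimately have S': "S' \<in> Sym2_nonneg" by (simp add: Sym2_nonneg_def)
    have sub: "range ((*v) S') \<subseteq> range ((*v) S)"
    proof clarify
      fix x
      have "S' *v x = S *v (x - ((x \<bullet> (S *v y)) / q) *\<^sub>R y)"
        by (simp add: S'v matrix_vector_mult_diff_distrib matrix_vector_mult_scaleR)
      then show "S' *v x \<in> range ((*v) S)" by simp
    qed
    \<comment> \<open>The whole range of \<open>S'\<close> is orthogonal to \<open>y\<close>, while
      \<open>S *v y\<close> is not. Hence the range loses at least one dimension.\<close>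
    have orth: "y \<bullet> (S' *v x) = 0" for x
    proof -
      have "y \<bullet> (S *v x) = x \<bullet> (S *v y)"
        using insert.prems(1) by (intro symmetric_matrix_inner_commute) (simp add: Sym2_nonneg_def)
      then show ?thesis
        using q by (simp add: S'v inner_diff_right q_def form_sq_def)
    qed
    have "S *v y \<notin> range ((*v) S')"
      using orth q by (force simp: q_def form_sq_def)
    with sub have "range ((*v) S') \<subset> range ((*v) S)" by blast
    moreover have "subspace (range ((*v) S'))" "subspace (range ((*v) S))"
      by (simp_all add: linear_subspace_image)
    ultimately have "dim (range ((*v) S')) < dim (range ((*v) S))"
      by (intro dim_psubset) (simp add: span_eq_iff[THEN iffD2])
    then have "dim (range ((*v) S')) \<le> card I"
      using insert.prems(2) insert.hyps by simp
    from insert.IH[OF S' this] obtain v where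
      v: "\<And>x. form_sq S' x = (\<Sum>i\<in>I. (v i \<bullet> x)\<^sup>2)" by blast
    define v' where "v' = v(j := (1 / sqrt q) *\<^sub>R (S *v y))"
    have "form_sq S x = (\<Sum>i\<in>insert j I. (v' i \<bullet> x)\<^sup>2)" for x
    proof -
      have "(\<Sum>i\<in>I. (v' i \<bullet> x)\<^sup>2) = (\<Sum>i\<in>I. (v i \<bullet> x)\<^sup>2)"
        using insert.hyps by (intro sum.cong) (auto simp: v'_def)
      then show ?thesis
        using insert.hyps q
        by (simp add: form v) (simp add: v'_def power_divide inner_commute)
    qed
    then show ?thesis by blast
  qed
qed

text \<open>Indexing the squares by the coordinates makes \<open>L\<close> a square matrix, whose
  rows are the functionals.\<close>

lemma Sym2_nonneg_factorization:
  fixes S :: "real ^ 'n ^ 'n"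
  assumes "S \<in> Sym2_nonneg"
  obtains L :: "real ^ 'n ^ 'n" where "\<And>x. form_sq S x = (norm (L *v x))\<^sup>2"
proof -
  have "dim (range ((*v) S)) \<le> card (UNIV :: 'n set)"
    using dim_subset_UNIV[of "range ((*v) S)"] by simp
  from Sym2_nonneg_sum_squares[OF finite assms this] obtain v :: "'n \<Rightarrow> real ^ 'n"
    where v: "\<And>x. form_sq S x = (\<Sum>i\<in>UNIV. (v i \<bullet> x)\<^sup>2)" by blast
  have "form_sq S x = (norm ((\<chi> i. v i) *v x))\<^sup>2" for x
    unfolding power2_norm_eq_inner
    by (simp add: v inner_vec_def matrix_vector_mult_def power2_eq_square)
  then show thesis by (rule that)
qed

section \<open>Direct sum components and isometries between ranges\<close>

lemma component_unique:
  assumes "direct_sum_decomp W W'" "u \<in> W" "v \<in> W'"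
  shows "component W W' (u + v) = u"
  unfolding component_def
proof (rule the_equality)
  show "u \<in> W \<and> u + v - u \<in> W'" using assms by simp
next
  fix u' assume u': "u' \<in> W \<and> u + v - u' \<in> W'"
  have "u - u' \<in> W"
    using assms u' by (auto simp: direct_sum_decomp_def intro: subspace_diff)
  moreover have "(u + v - u') - v \<in> W'"
    using assms u' subspace_diff[of W' "u + v - u'" v] by (simp add: direct_sum_decomp_def)
  moreover have "(u + v - u') - v = u - u'" by simp
  ultimately have "u - u' \<in> W \<inter> W'" by simp
  then have "u - u' = 0" using assms(1) unfolding direct_sum_decomp_def by blast
  then show "u' = u" by simp
qed

lemma direct_sum_decomp_commute: "direct_sum_decomp W W' \<Longrightarrow> direct_sum_decomp W' W"
  unfolding direct_sum_decomp_def by (metis add.commute inf_commute)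

lemma component_props:
  assumes d: "direct_sum_decomp W W'"
  shows component_in: "component W W' x \<in> W"
    and component_in': "component W' W x \<in> W'"
    and component_add: "component W W' x + component W' W x = x"
    and component_id: "u \<in> W \<Longrightarrow> component W W' u = u"
    and component_null: "u \<in> W \<Longrightarrow> component W' W u = 0"
    and linear_component: "linear (component W W')"
proof -
  have sub: "subspace W" "subspace W'" using d by (auto simp: direct_sum_decomp_def)
  have ex: "\<exists>u\<in>W. \<exists>v\<in>W'. x = u + v" for x
    using d by (simp add: direct_sum_decomp_def)
  note c = component_unique[OF d] component_unique[OF direct_sum_decomp_commute[OF d]]
  have all: "component W W' x \<in> W \<and> component W' W x \<in> W' \<and>
      component W W' x + component W' W x = x" for x
    using ex[of x] c by (metis add.commute)
  then show "component W W' x \<in> W" "component W' W x \<in> W'"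
    "component W W' x + component W' W x = x" by auto
  show "u \<in> W \<Longrightarrow> component W W' u = u" "u \<in> W \<Longrightarrow> component W' W u = 0"
    using c(1)[of u 0] c(2)[of 0 u] sub by (auto simp: subspace_0)
  show "linear (component W W')"
  proof (rule linearI)
    fix x y
    have "component W W' ((component W W' x + component W W' y) + (component W' W x + component W' W y))
      = component W W' x + component W W' y"
      using all sub by (intro c) (auto intro: subspace_add)
    moreover have "(component W W' x + component W W' y) + (component W' W x + component W' W y) = x + y"
      using all[of x] all[of y] by (metis add.assoc add.left_commute)
    ultimately show "component W W' (x + y) = component W W' x + component W W' y" by simp
  next
    fix r x
    have "component W W' (r *\<^sub>R component W W' x + r *\<^sub>R component W' W x) = r *\<^sub>R component W W' x"
      using all sub by (intro c) (auto intro: subspace_scale)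
    then show "component W W' (r *\<^sub>R x) = r *\<^sub>R component W W' x"
      using all[of x] by (metis scaleR_right_distrib)
  qed
qed

text \<open>Equality of norms makes \<open>B *v x \<mapsto> A *v x\<close> a well-defined isometry
  between the ranges. The ranges then have equal dimension, hence so do their orthogonal
  complements, and any isometry of the complements extends it to the whole space.\<close>

lemma isometry_between_ranges:
  fixes A B :: "real ^ 'n ^ 'n"
  assumes eq: "\<And>x. norm (A *v x) = norm (B *v x)"
  obtains Q :: "real ^ 'n ^ 'n" where "orthogonal_matrix Q" "A = Q ** B"
proof -
  let ?S = "range ((*v) B)" and ?T = "range ((*v) A)"
  let ?S' = "{y. \<forall>x\<in>?S. orthogonal x y}" and ?T' = "{y. \<forall>x\<in>?T. orthogonal x y}"
  have sub: "subspace ?S" "subspace ?T"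
    by (simp_all add: linear_subspace_image)
  have sub': "subspace ?S'" "subspace ?T'"
    by (auto simp: subspace_def orthogonal_clauses)
  \<comment> \<open>A linear choice of preimages under \<open>B\<close>. The choice does not affect
    \<open>h\<close> on the range, because \<open>A\<close> vanishes wherever \<open>B\<close>
    does.\<close>
  obtain g where g: "linear g" "\<And>v. v \<in> ?S \<Longrightarrow> B *v (g v) = v"
    using linear_exists_right_inverse_on[of "(*v) B" UNIV] by auto
  define h where "h v = A *v (g v)" for v
  have lin_h: "linear h"
    unfolding h_def using linear_compose[OF g(1) matrix_vector_mul_linear[of A]] by (simp add: o_def)
  have hnorm: "norm (h v) = norm v" if "v \<in> ?S" for v
    using g(2)[OF that] eq[of "g v"] by (simp add: h_def)
  have hB: "h (B *v x) = A *v x" for x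
  proof -
    have "norm (A *v (g (B *v x) - x)) = norm (B *v (g (B *v x) - x))" by (rule eq)
    also have "\<dots> = 0" using g(2)[of "B *v x"] by (simp add: matrix_vector_mult_diff_distrib)
    finally show ?thesis by (simp add: h_def matrix_vector_mult_diff_distrib)
  qed
  have "inj_on h ?S"
  proof (rule inj_onI)
    fix x y assume xy: "x \<in> ?S" "y \<in> ?S" "h x = h y"
    have "norm (h (x - y)) = norm (x - y)"
      using xy sub by (intro hnorm subspace_diff)
    then show "x = y" using xy by (simp add: linear_diff[OF lin_h])
  qed
  then have "dim (h ` ?S) = dim ?S"
    by (intro dim_image_eq[OF lin_h]) (simp add: span_eq_iff[THEN iffD2, OF sub(1)])
  moreover have "h ` ?S = ?T" by (auto simp: hB image_iff)
  ultimately have "dim ?S = dim ?T" by simp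
  then have "dim ?S' = dim ?T'"
    using dim_subspace_orthogonal_to_vectors[OF sub(1) subspace_UNIV]
      dim_subspace_orthogonal_to_vectors[OF sub(2) subspace_UNIV] by simp
  then obtain f where f: "linear f" "f ` ?S' = ?T'" "\<And>x. x \<in> ?S' \<Longrightarrow> norm (f x) = norm x"
    by (rule isometries_subspaces[OF sub']) blast
  have d: "direct_sum_decomp ?S ?S'"
    unfolding direct_sum_decomp_def
  proof (intro conjI sub sub' allI)
    show "?S \<inter> ?S' = {0}"
      using subspace_0[OF sub(1)] subspace_0[OF sub'(1)] by (auto simp: orthogonal_def) (metis inner_eq_zero_iff)
    fix x
    have span: "span ?S = ?S" using sub(1) by (simp add: span_eq_iff)
    obtain y z where yz: "y \<in> ?S" "\<And>w. w \<in> ?S \<Longrightarrow> orthogonal z w" "x = y + z"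
      by (rule orthogonal_subspace_decomp_exists[of ?S x]) (auto simp: span)
    then have "z \<in> ?S'" unfolding mem_Collect_eq by (metis orthogonal_commute)
    with yz show "\<exists>u\<in>?S. \<exists>v\<in>?S'. x = u + v"
by blast
  qed
  define p p' where "p = component ?S ?S'" and "p' = component ?S' ?S"
  \<comment> \<open>The two isometries have orthogonal images, so Pythagoras makes their sum an
    isometry.\<close>
  define q where "q x = h (p x) + f (p' x)" for x
  have lin_q: "linear q"
    unfolding q_def p_def p'_def
    by (intro linear_compose_add linear_compose[unfolded o_def, OF _ lin_h]
        linear_compose[unfolded o_def, OF _ f(1)] linear_component d direct_sum_decomp_commute)
  have "norm (q x) = norm x" for x
  proof -
    have p: "p x \<in> ?S" "p' x \<in> ?S'" "p x + p' x = x"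
      using component_props[OF d] by (auto simp: p_def p'_def)
    have "h (p x) \<in> ?T" using p(1) by (auto simp: hB)
    moreover have "f (p' x) \<in> ?T'" using p(2) f(2) by blast
    ultimately have "orthogonal (h (p x)) (f (p' x))" by blast
    then have "(norm (q x))\<^sup>2 = (norm (p x))\<^sup>2 + (norm (p' x))\<^sup>2"
      by (simp add: q_def norm_add_Pythagorean hnorm[OF p(1)] f(3)[OF p(2)])
    also have "\<dots> = (norm (p x + p' x))\<^sup>2"
      using p by (subst norm_add_Pythagorean) auto
    finally show ?thesis using p(3) by (simp add: power2_eq_iff_nonneg)
  qed
  then have "orthogonal_transformation q"
    using lin_q by (simp add: orthogonal_transformation)
  then have "orthogonal_matrix (matrix q)"
    by (simp add: orthogonal_transformation_matrix)
  moreover have "A = matrix q ** B"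
  proof -
    have "A *v x = (matrix q ** B) *v x" for x
    proof -
      have "p (B *v x) = B *v x" "p' (B *v x) = 0"
        using component_id[OF d, of "B *v x"] component_null[OF d, of "B *v x"] by (auto simp: p_def p'_def)
      then have "q (B *v x) = A *v x" by (simp add: q_def hB linear_0[OF f(1)])
      then show ?thesis
        by (simp add: matrix_vector_mul_assoc[symmetric] matrix_vector_mul(2)[OF lin_q])
    qed
    then show ?thesis by (simp add: matrix_eq)
  qed
  ultimately show thesis by (rule that)
qed

section \<open>Invariance of Lebesgue measure under linear maps that preserve a set\<close>

lemma nn_integral_lborel_translate:
  fixes f :: "'a::euclidean_space \<Rightarrow> ennreal"
  assumes [measurable]: "f \<in> borel_measurable borel"
  shows "(\<integral>\<^sup>+x. f (c + x) \<partial>lborel) = (\<integral>\<^sup>+x. f x \<partial>lborel)"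
  by (subst (2) lborel_distr_plus[symmetric, of c]) (simp add: nn_integral_distr)

text \<open>Weil's uniqueness argument for Haar measure, with the invariant set fixing the constant.\<close>
lemma lborel_distr_linear_invariant:
  fixes L L' :: "'a::euclidean_space \<Rightarrow> 'a"
  assumes lin: "linear L" and inv: "\<And>x. L (L' x) = x"
    and E: "E \<in> sets borel" "emeasure lborel E \<noteq> 0" "emeasure lborel E \<noteq> \<infinity>"
    and LE: "\<And>x. L x \<in> E \<longleftrightarrow> x \<in> E" and sym: "\<And>x. - x \<in> E \<longleftrightarrow> x \<in> E"
  shows "distr lborel borel L = lborel"
proof (rule measure_eqI)
  fix S assume "S \<in> sets (distr lborel borel L)"
  then have S[measurable]: "S \<in> sets borel" by simp
  note E(1)[measurable]
  have [measurable]: "L \<in> borel_measurable borel"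
    using lin by (intro borel_measurable_continuous_onI linear_continuous_on) (simp add: linear_conv_bounded_linear)
  \<comment> \<open>The double integral of the indicators of \<open>L x + y \<in> S\<close> and
    \<open>y \<in> E\<close> is computed in both orders. For fixed \<open>y\<close>, the shift by
    \<open>y = L (L' y)\<close> is absorbed by translating \<open>x\<close>.\<close>
  have "emeasure (distr lborel borel L) S * emeasure lborel E =
      (\<integral>\<^sup>+y. (\<integral>\<^sup>+x. indicator S (L x) \<partial>lborel) * indicator E y \<partial>lborel)"
  proof -
    have "(\<integral>\<^sup>+x. indicator S (L x) \<partial>lborel) = emeasure (distr lborel borel L) S"
      by (subst nn_integral_distr[where M=lborel and M'=borel and T=L and f="indicator S", symmetric]) simp_all
    then show ?thesis by (simp add: nn_integral_cmult)
  qed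
  also have "\<dots> = (\<integral>\<^sup>+y. (\<integral>\<^sup>+x. indicator S (L x + y) * indicator E y \<partial>lborel) \<partial>lborel)"
  proof (rule nn_integral_cong)
    fix y
    have "(\<integral>\<^sup>+x. indicator S (L (L' y + x)) \<partial>lborel) = (\<integral>\<^sup>+x. indicator S (L x) \<partial>lborel :: ennreal)"
      by (rule nn_integral_lborel_translate[of "\<lambda>x. indicator S (L x)" "L' y"]) simp
    then have "(\<integral>\<^sup>+x. indicator S (L x + y) \<partial>lborel) = (\<integral>\<^sup>+x. indicator S (L x) \<partial>lborel :: ennreal)"
      by (simp add: linear_add[OF lin] inv add.commute)
    then show "(\<integral>\<^sup>+x. indicator S (L x) \<partial>lborel) * indicator E y =
        (\<integral>\<^sup>+x. indicator S (L x + y) * indicator E y \<partial>lborel :: ennreal)"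
      by (simp add: nn_integral_multc)
  qed
  also have "\<dots> = (\<integral>\<^sup>+x. (\<integral>\<^sup>+y. indicator S (L x + y) * indicator E y \<partial>lborel) \<partial>lborel)"
    by (rule lborel_pair.Fubini') simp
  \<comment> \<open>In the other order the shift is moved from \<open>S\<close> to \<open>E\<close>
    by translating \<open>y\<close>.\<close>
  also have "\<dots> = (\<integral>\<^sup>+x. (\<integral>\<^sup>+y. indicator S y * indicator E (y - L x) \<partial>lborel) \<partial>lborel)"
  proof (rule nn_integral_cong)
    fix x
    show "(\<integral>\<^sup>+y. indicator S (L x + y) * indicator E y \<partial>lborel) =
        (\<integral>\<^sup>+y. indicator S y * indicator E (y - L x) \<partial>lborel :: ennreal)"
      using nn_integral_lborel_translate[of "\<lambda>y. indicator S y * indicator E (y - L x)" "L x"] by simp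
  qed
  also have "\<dots> = (\<integral>\<^sup>+y. (\<integral>\<^sup>+x. indicator S y * indicator E (y - L x) \<partial>lborel) \<partial>lborel)"
    by (rule lborel_pair.Fubini'[symmetric]) simp
  also have "\<dots> = (\<integral>\<^sup>+y. indicator S y * emeasure lborel E \<partial>lborel)"
  proof (rule nn_integral_cong)
    fix y
    \<comment> \<open>The two symmetries of \<open>E\<close> remove \<open>L\<close> and the sign,
      so the inner set is a translate of \<open>E\<close> and has its measure.\<close>
    have "y - L x \<in> E \<longleftrightarrow> - L' y + x \<in> E" for x
    proof -
      have "y - L x = L (- (- L' y + x))"
        by (simp add: linear_add[OF lin] linear_neg[OF lin] linear_diff[OF lin] inv)
      then show ?thesis by (simp only: LE sym)
    qed
    then have "(\<integral>\<^sup>+x. indicator E (y - L x) \<partial>lborel) =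
        (\<integral>\<^sup>+x. indicator E (- L' y + x) \<partial>lborel :: ennreal)"
      by (simp add: indicator_def)
    also have "\<dots> = (\<integral>\<^sup>+x. indicator E x \<partial>lborel)"
      by (rule nn_integral_lborel_translate) simp
    finally show "(\<integral>\<^sup>+x. indicator S y * indicator E (y - L x) \<partial>lborel) =
        indicator S y * emeasure lborel E"
      by (simp add: nn_integral_cmult)
  qed
  also have "\<dots> = emeasure lborel S * emeasure lborel E"
    by (simp add: nn_integral_multc)
  finally show "emeasure (distr lborel borel L) S = emeasure lborel S"
    using E by (metis ennreal_mult_divide_eq infinity_ennreal_def)
qed simp

section \<open>Positive definite forms, their inverses and their isometries\<close>

lemma matrix_inverse_vector_mult:
  fixes N N' :: "real ^ 'n ^ 'n"
  assumes "N ** N' = mat 1"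
  shows "N *v (N' *v x) = x" "N' *v (N *v x) = x"
    "transpose N *v (transpose N' *v x) = x" "transpose N' *v (transpose N *v x) = x"
proof -
  have 1: "N' ** N = mat 1" using assms by (simp add: matrix_left_right_inverse)
  have 2: "transpose N' ** transpose N = mat 1" using assms by (simp flip: matrix_transpose_mul add: transpose_mat)
  then have 3: "transpose N ** transpose N' = mat 1" by (simp add: matrix_left_right_inverse)
  show "N *v (N' *v x) = x" "N' *v (N *v x) = x"
    "transpose N *v (transpose N' *v x) = x" "transpose N' *v (transpose N *v x) = x"
    unfolding matrix_vector_mul_assoc assms 1 2 3 by simp_all
qed

lemma pos_def_invertible:
  fixes C :: "real ^ 'n ^ 'n"
  assumes "\<And>\<omega>. \<omega> \<noteq> 0 \<Longrightarrow> form_sq C \<omega> > 0"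
  shows "C ** matrix_inv C = mat 1"
proof -
  have "C *v x = 0 \<Longrightarrow> x = 0" for x
    using assms[of x] by (auto simp: form_sq_def)
  then have "\<exists>B. B ** C = mat 1"
    by (simp add: matrix_left_invertible_ker)
  then have "invertible C" by (simp add: invertible_left_inverse)
  then show ?thesis
    unfolding invertible_def matrix_inv_def by (rule someI_ex[THEN conjunct1])
qed

text \<open>Writing \<open>C\<close> as \<open>transpose N ** N\<close> gives
  \<open>N' ** transpose N'\<close> for its inverse. So \<open>N\<close> and
  \<open>transpose N'\<close> turn the norms on the dual space and on \<open>V\<close> into
  Euclidean norms.\<close>

lemma pos_def_factorization:
  fixes C :: "real ^ 'n ^ 'n"
  assumes sym: "transpose C = C" and pos: "\<And>\<omega>. \<omega> \<noteq> 0 \<Longrightarrow> form_sq C \<omega> > 0"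
  obtains N N' :: "real ^ 'n ^ 'n" where "N ** N' = mat 1"
    "\<And>\<omega>. form_sq C \<omega> = (norm (N *v \<omega>))\<^sup>2"
    "\<And>x. form_sq (matrix_inv C) x = (norm (transpose N' *v x))\<^sup>2"
proof -
  have "0 \<le> form_sq C x" for x
    using pos[of x] by (cases "x = 0") (auto simp: form_sq_def)
  then have "C \<in> Sym2_nonneg" using sym by (auto simp: Sym2_nonneg_def)
  then obtain N :: "real ^ 'n ^ 'n" where N: "\<And>x. form_sq C x = (norm (N *v x))\<^sup>2"
    by (rule Sym2_nonneg_factorization) blast
  have "N *v x = 0 \<Longrightarrow> x = 0" for x
    using pos[of x] by (cases "x = 0") (simp_all add: N)
  then obtain N' where "N' ** N = mat 1"
    using matrix_left_invertible_ker[of N] by blast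
  then have NN: "N ** N' = mat 1" by (simp add: matrix_left_right_inverse)
  \<comment> \<open>Polarisation of the identity of quadratic forms.\<close>
  have bil: "x \<bullet> (C *v y) = (N *v x) \<bullet> (N *v y)" for x y
  proof -
    have "form_sq C (x + 1 *\<^sub>R y) = form_sq C x + 2 * (x \<bullet> (C *v y)) + form_sq C y"
      by (subst form_sq_add_scaleR[OF sym]) simp
    then show ?thesis
      by (simp add: N power2_norm_eq_inner matrix_vector_right_distrib inner_add_left inner_add_right inner_commute)
  qed
  have "form_sq (matrix_inv C) x = (norm (transpose N' *v x))\<^sup>2" for x
  proof -
    define \<eta> where "\<eta> = matrix_inv C *v x"
    have x: "x = C *v \<eta>"
      using matrix_inverse_vector_mult(1)[OF pos_def_invertible[OF pos]] by (simp add: \<eta>_def)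
    have "y \<bullet> (transpose N' *v x) = y \<bullet> (N *v \<eta>)" for y
    proof -
      have "y \<bullet> (transpose N' *v x) = (N' *v y) \<bullet> (C *v \<eta>)"
        unfolding x by (subst inner_matrix_vector_transpose) (simp only: transpose_transpose)
      also have "\<dots> = y \<bullet> (N *v \<eta>)"
        unfolding bil by (simp add: matrix_inverse_vector_mult[OF NN])
      finally show ?thesis .
    qed
    then have "transpose N' *v x = N *v \<eta>" by (metis vector_eq_ldot)
    then have "(norm (transpose N' *v x))\<^sup>2 = form_sq C \<eta>" by (simp add: N)
    also have "\<dots> = form_sq (matrix_inv C) x"
      by (simp add: form_sq_def x[symmetric]) (simp add: \<eta>_def inner_commute)
    finally show ?thesis by simp
  qed
  then show thesis using that NN N by blast
qed

text \<open>A Euclidean root of \<open>S\<close> is carried to the geometry of \<open>V\<close> by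
  \<open>transpose N\<close>. This provides a witness for the choice of \<open>U\<close> in
  \<open>J_form\<close>.\<close>

lemma Sym2_nonneg_form_root:
  fixes C S :: "real ^ 'n ^ 'n"
  assumes "transpose C = C" "\<And>\<omega>. \<omega> \<noteq> 0 \<Longrightarrow> form_sq C \<omega> > 0" "S \<in> Sym2_nonneg"
  shows "\<exists>U. \<forall>x. form_sq S x = form_sq (matrix_inv C) (U *v x)"
proof -
  obtain N N' :: "real ^ 'n ^ 'n" where N: "N ** N' = mat 1"
    "\<And>x. form_sq (matrix_inv C) x = (norm (transpose N' *v x))\<^sup>2"
    by (rule pos_def_factorization[OF assms(1,2)]) blast+
  obtain L :: "real ^ 'n ^ 'n" where L: "\<And>x. form_sq S x = (norm (L *v x))\<^sup>2"
    by (rule Sym2_nonneg_factorization[OF assms(3)]) blast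
  have "form_sq S x = form_sq (matrix_inv C) ((transpose N ** L) *v x)" for x
    unfolding N(2) L matrix_vector_mul_assoc[symmetric] matrix_inverse_vector_mult(4)[OF N(1)] ..
  then show ?thesis by blast
qed

text \<open>The adjoint of the isometry that extends \<open>B x \<mapsto> A x\<close>.\<close>
lemma form_isometry_adjoint:
  fixes A B C :: "real ^ 'n ^ 'n"
  assumes "transpose C = C" "\<And>\<omega>. \<omega> \<noteq> 0 \<Longrightarrow> form_sq C \<omega> > 0"
    and eq: "\<And>x. form_sq (matrix_inv C) (A *v x) = form_sq (matrix_inv C) (B *v x)"
  obtains L L' :: "real ^ 'n ^ 'n" where "L ** L' = mat 1"
    "\<And>\<omega>. form_sq C (L *v \<omega>) = form_sq C \<omega>"
    "\<And>x \<omega>. (L *v \<omega>) \<bullet> (B *v x) = \<omega> \<bullet> (A *v x)"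
proof -
  obtain N N' :: "real ^ 'n ^ 'n" where N: "N ** N' = mat 1"
    "\<And>\<omega>. form_sq C \<omega> = (norm (N *v \<omega>))\<^sup>2"
    "\<And>x. form_sq (matrix_inv C) x = (norm (transpose N' *v x))\<^sup>2"
    by (rule pos_def_factorization[OF assms(1,2)]) blast+
  note NN = matrix_inverse_vector_mult[OF N(1)]
  have "norm ((transpose N' ** A) *v x) = norm ((transpose N' ** B) *v x)" for x
    using eq[of x] by (simp add: N(3) matrix_vector_mul_assoc power2_eq_iff_nonneg)
  then obtain Q where Q: "orthogonal_matrix Q" "transpose N' ** A = Q ** (transpose N' ** B)"
    using isometry_between_ranges by metis
  \<comment> \<open>In the original coordinates the isometry that sends \<open>B *v x\<close> to
    \<open>A *v x\<close> is \<open>transpose N ** Q ** transpose N'\<close>; \<open>L\<close> is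
    its transpose.\<close>
  define L L' where "L = N' ** transpose Q ** N" and "L' = N' ** Q ** N"
  have QQ: "Q ** transpose Q = mat 1" "transpose Q ** Q = mat 1"
    using Q(1) by (auto simp: orthogonal_matrix_def)
  have Lv: "L *v x = N' *v (transpose Q *v (N *v x))" "L' *v x = N' *v (Q *v (N *v x))" for x
    by (simp_all only: L_def L'_def matrix_vector_mul_assoc[symmetric])
  have "L *v (L' *v x) = x" for x
    by (simp only: Lv NN matrix_inverse_vector_mult[OF QQ(1)])
  then have "L ** L' = mat 1" by (simp add: matrix_eq matrix_vector_mul_assoc)
  moreover have "form_sq C (L *v \<omega>) = form_sq C \<omega>" for \<omega>
  proof -
    have "orthogonal_matrix (transpose Q)" using Q(1) by (simp add: orthogonal_matrix_transpose)
    then have "orthogonal_transformation ((*v) (transpose Q))"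
      by (simp add: orthogonal_transformation_matrix)
    then have "norm (transpose Q *v y) = norm y" for y
      by (rule orthogonal_transformation_norm)
    then show ?thesis by (simp only: N Lv NN)
  qed
  moreover have "(L *v \<omega>) \<bullet> (B *v x) = \<omega> \<bullet> (A *v x)" for x \<omega>
  proof -
    have "(L *v \<omega>) \<bullet> (B *v x) = (N *v \<omega>) \<bullet> (Q *v (transpose N' *v (B *v x)))"
      by (simp add: Lv inner_matrix_vector_transpose del: transpose_matrix_vector)
    also have "Q *v (transpose N' *v (B *v x)) = transpose N' *v (A *v x)"
      using arg_cong[OF Q(2), of "\<lambda>T. T *v x"] by (simp only: matrix_vector_mul_assoc)
    also have "(N *v \<omega>) \<bullet> (transpose N' *v (A *v x)) = \<omega> \<bullet> (A *v x)"
      by (simp only: inner_matrix_vector_transpose transpose_transpose NN)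
    finally show ?thesis .
  qed
  ultimately show thesis by (rule that)
qed

section \<open>Fourier representations and the objective\<close>

text \<open>The open unit ball of \<open>C\<close> serves as the invariant set in Weil's argument:
  it is preserved by \<open>L\<close> and by negation, is open and nonempty, and is bounded as part
  of a linear image of a Euclidean ball.\<close>

lemma distr_lborel_form_isometry:
  fixes C L L' :: "real ^ 'n ^ 'n"
  assumes C: "transpose C = C" "\<And>\<omega>. \<omega> \<noteq> 0 \<Longrightarrow> form_sq C \<omega> > 0"
    and L: "L ** L' = mat 1" "\<And>\<omega>. form_sq C (L *v \<omega>) = form_sq C \<omega>"
  shows "distr lborel borel ((*v) L) = lborel"
proof -
  define E where "E = {\<omega>. form_sq C \<omega> < 1}"
  obtain N N' :: "real ^ 'n ^ 'n" where N: "N ** N' = mat 1" "\<And>\<omega>. form_sq C \<omega> = (norm (N *v \<omega>))\<^sup>2"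
    by (rule pos_def_factorization[OF C]) blast+
  have "open E"
    unfolding E_def form_sq_def by (intro open_Collect_less continuous_intros)
  then have E: "E \<in> sets borel" by simp
  have "bounded ((*v) N' ` ball 0 1)"
    by (intro bounded_linear_image) (auto simp: matrix_vector_mul_bounded_linear)
  moreover have "E \<subseteq> (*v) N' ` ball 0 1"
  proof
    fix \<omega> assume "\<omega> \<in> E"
    then have "N *v \<omega> \<in> ball 0 1" by (simp add: E_def N(2) power_less_one_iff)
    then show "\<omega> \<in> (*v) N' ` ball 0 1"
      using matrix_inverse_vector_mult(2)[OF N(1), of \<omega>] by (metis image_eqI)
  qed
  ultimately have "emeasure lborel E < \<infinity>"
    by (intro emeasure_bounded_finite) (rule bounded_subset)
  moreover have "emeasure lborel E \<noteq> 0"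
  proof
    assume "emeasure lborel E = 0"
    then have "E \<in> null_sets lborel" using E by auto
    then have "negligible E" by (simp add: negligible_iff_null_sets null_sets_completionI)
    moreover have "0 \<in> E" by (simp add: E_def form_sq_def)
    ultimately show False using \<open>open E\<close> open_not_negligible by blast
  qed
  moreover have "- x \<in> E \<longleftrightarrow> x \<in> E" for x
    by (simp add: E_def form_sq_def linear_neg[OF matrix_vector_mul_linear])
  ultimately show ?thesis
    using E L matrix_inverse_vector_mult(1)[OF L(1)]
    by (intro lborel_distr_linear_invariant[of _ "(*v) L'" E]) (auto simp: E_def)
qed

section \<open>Plane waves and Fourier densities\<close>

abbreviation wave :: "real ^ 'n \<Rightarrow> real ^ 'n \<Rightarrow> complex" where
  "wave \<omega> x \<equiv> exp (2 * of_real pi * \<i> * of_real (\<omega> \<bullet> x))"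

lemma norm_wave: "norm (wave \<omega> x) = 1"
  by (simp add: norm_exp_eq_Re)

lemma wave_add: "wave \<omega> (x + y) = wave \<omega> x * wave \<omega> y"
  by (simp add: inner_add_right algebra_simps flip: exp_add)

text \<open>Pointwise, the elementary bound \<open>a \<le> a\<^sup>2 / k + k\<close> dominates the
  density by an integrable function.\<close>

lemma fourier_rep_integrable:
  fixes k :: "real ^ 'n \<Rightarrow> real"
  assumes k: "\<And>\<omega>. k \<omega> > 0" "integrable lborel k" and rep: "fourier_rep k f fh"
  shows "integrable lborel fh"
proof (rule Bochner_Integration.integrable_bound)
  show "integrable lborel (\<lambda>\<omega>. (cmod (fh \<omega>))\<^sup>2 / k \<omega> + k \<omega>)"
    using rep k by (intro Bochner_Integration.integrable_add) (auto simp: fourier_rep_def)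
  show "fh \<in> borel_measurable lborel" using rep by (simp add: fourier_rep_def)
  have "cmod (fh \<omega>) \<le> (cmod (fh \<omega>))\<^sup>2 / k \<omega> + k \<omega>" for \<omega>
  proof -
    have "0 \<le> (cmod (fh \<omega>) - k \<omega>)\<^sup>2 + cmod (fh \<omega>) * k \<omega>"
      using k(1)[of \<omega>] by (simp add: add_nonneg_nonneg)
    then have "cmod (fh \<omega>) * k \<omega> \<le> (cmod (fh \<omega>))\<^sup>2 + k \<omega> * k \<omega>"
      by (simp add: power2_eq_square algebra_simps)
    then show ?thesis using k(1)[of \<omega>] by (simp add: field_simps)
  qed
  then show "AE \<omega> in lborel. norm (fh \<omega>) \<le> norm ((cmod (fh \<omega>))\<^sup>2 / k \<omega> + k \<omega>)"
    using k(1) by (intro AE_I2) (simp add: less_imp_le)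
qed

lemma fourier_rep_bounded_measurable:
  fixes k :: "real ^ 'n \<Rightarrow> real"
  assumes k: "\<And>\<omega>. k \<omega> > 0" "integrable lborel k" and rep: "fourier_rep k f fh"
  shows "f \<in> borel_measurable borel" "\<And>x. norm (f x) \<le> (LINT \<omega>|lborel. norm (fh \<omega>))"
proof -
  have int: "integrable lborel fh" by (rule fourier_rep_integrable[OF assms])
  then have [measurable]: "fh \<in> borel_measurable borel" by auto
  have f: "f x = (LINT \<omega>|lborel. fh \<omega> * wave \<omega> x)" for x
    using rep by (simp add: fourier_rep_def)
  have "(\<lambda>x. LINT \<omega>|lborel. fh \<omega> * wave \<omega> x) \<in> borel_measurable borel" by measurable
  then show "f \<in> borel_measurable borel" by (simp add: f[abs_def] cong: measurable_cong)
  show "norm (f x) \<le> (LINT \<omega>|lborel. norm (fh \<omega>))" for x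
    unfolding f by (rule order_trans[OF integral_norm_bound]) (simp add: norm_mult norm_wave)
qed

text \<open>Fubini, with \<open>F\<close> as a weight. It reduces every expectation that is linear
  in a competitor to expectations of weighted plane waves.\<close>

lemma integral_fourier_rep:
  fixes k :: "real ^ 'n \<Rightarrow> real" and T :: "'b \<Rightarrow> real ^ 'n" and F :: "'b \<Rightarrow> complex"
  assumes k: "\<And>\<omega>. k \<omega> > 0" "integrable lborel k" and rep: "fourier_rep k f fh"
    and M: "prob_space M" and T: "T \<in> borel_measurable M" and F: "integrable M F"
  shows "(LINT p|M. F p * f (T p)) = (LINT \<omega>|lborel. fh \<omega> * (LINT p|M. F p * wave \<omega> (T p)))"
proof -
  have int: "integrable lborel fh" by (rule fourier_rep_integrable[OF k rep])
  then have [measurable]: "fh \<in> borel_measurable borel" by auto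
  note T[measurable] F[THEN borel_measurable_integrable, measurable]
  interpret M: prob_space M by fact
  interpret pair_sigma_finite M "lborel :: (real ^ 'n) measure" ..
  have "integrable (M \<Otimes>\<^sub>M lborel) (\<lambda>(p, \<omega>). fh \<omega> * (F p * wave \<omega> (T p)))"
  proof (rule Fubini_integrable)
    show "integrable M (\<lambda>p. LINT \<omega>|lborel. norm (case (p, \<omega>) of (p, \<omega>) \<Rightarrow> fh \<omega> * (F p * wave \<omega> (T p))))"
      using F int by (simp add: norm_mult norm_wave)
    show "AE p in M. integrable lborel (\<lambda>\<omega>. case (p, \<omega>) of (p, \<omega>) \<Rightarrow> fh \<omega> * (F p * wave \<omega> (T p)))"
    proof (intro AE_I2)
      fix p
      have "integrable lborel (\<lambda>\<omega>. F p * fh \<omega>)" using int by simp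
      then show "integrable lborel (\<lambda>\<omega>. case (p, \<omega>) of (p, \<omega>) \<Rightarrow> fh \<omega> * (F p * wave \<omega> (T p)))"
        by (rule Bochner_Integration.integrable_bound) (auto simp: norm_mult norm_wave)
    qed
  qed simp
  from Fubini_integral[OF this]
  have "(LINT \<omega>|lborel. LINT p|M. fh \<omega> * (F p * wave \<omega> (T p))) =
      (LINT p|M. LINT \<omega>|lborel. fh \<omega> * (F p * wave \<omega> (T p)))" .
  moreover have "(LINT \<omega>|lborel. fh \<omega> * (F p * wave \<omega> (T p))) = F p * f (T p)" for p
  proof -
    have "(LINT \<omega>|lborel. fh \<omega> * (F p * wave \<omega> (T p))) = (LINT \<omega>|lborel. F p * (fh \<omega> * wave \<omega> (T p)))"
      by (simp add: ac_simps)
    also have "\<dots> = F p * f (T p)" using rep by (simp add: fourier_rep_def)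
    finally show ?thesis .
  qed
  ultimately show ?thesis by simp
qed

text \<open>To compare the infima it suffices to turn each competitor for \<open>U\<close> into one
  for \<open>U'\<close> that is no worse in loss and in norm. Since \<open>rkhs_norm_sq\<close> is
  itself an infimum, the condition is put on densities, which makes Fourier uniqueness unnecessary
  here.\<close>

lemma J_lin_mono:
  fixes k :: "real ^ 'n \<Rightarrow> real" and U U' :: "real ^ 'n ^ 'n"
  assumes k: "\<And>\<omega>. k \<omega> > 0" and lam: "lam > 0"
    and step: "\<And>f fh. fourier_rep k f fh \<Longrightarrow> \<exists>f' fh'. fourier_rep k f' fh' \<and>
      (LINT \<omega>|lborel. (cmod (fh' \<omega>))\<^sup>2 / k \<omega>) \<le> (LINT \<omega>|lborel. (cmod (fh \<omega>))\<^sup>2 / k \<omega>) \<and>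
      (LINT p|M. (cmod (Y p - f' (U' *v X p)))\<^sup>2) \<le> (LINT p|M. (cmod (Y p - f (U *v X p)))\<^sup>2)"
  shows "J_lin M X Y k lam U' \<le> J_lin M X Y k lam U"
proof -
  define N where "N fh = (LINT \<omega>|lborel. (cmod (fh \<omega>))\<^sup>2 / k \<omega>)" for fh
  define L where "L U f = (LINT p|M. (cmod (Y p - f (U *v X p)))\<^sup>2)" for U :: "real ^ 'n ^ 'n" and f
  define R where "R f = rkhs_norm_sq k f" for f
  have N0: "0 \<le> N fh" for fh
    using k by (simp add: N_def integral_nonneg less_imp_le)
  have R: "R f = (INF fh\<in>{fh. fourier_rep k f fh}. N fh)" for f
    by (simp add: R_def rkhs_norm_sq_def N_def)
  have R_le: "R f \<le> N fh" if "fourier_rep k f fh" for f fh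
    unfolding R using that N0 by (intro cINF_lower bdd_belowI2[of _ 0]) auto
  have R0: "0 \<le> R f" if "fourier_rep k f fh" for f fh
    unfolding R using that N0 by (intro cINF_greatest) auto
  have "fourier_rep k (\<lambda>_. 0) (\<lambda>_. 0)" by (simp add: fourier_rep_def)
  then have ne: "rkhs k \<noteq> {}" by (auto simp: rkhs_def)
  have L0: "0 \<le> L U f" for U :: "real ^ 'n ^ 'n" and f by (simp add: L_def)
  have J: "J_lin M X Y k lam U = (INF f\<in>rkhs k. 1 / 2 * L U f + lam / 2 * R f)" for U
    by (simp add: J_lin_def L_def R_def)
  have J_le: "J_lin M X Y k lam U' \<le> 1 / 2 * L U f + lam / 2 * N fh" if rep: "fourier_rep k f fh" for f fh
  proof -
    obtain f' fh' where f': "fourier_rep k f' fh'" "N fh' \<le> N fh" "L U' f' \<le> L U f"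
      using step[OF rep] unfolding N_def L_def by blast
    have "J_lin M X Y k lam U' \<le> 1 / 2 * L U' f' + lam / 2 * R f'"
      unfolding J
    proof (rule cINF_lower)
      show "bdd_below ((\<lambda>f. 1 / 2 * L U' f + lam / 2 * R f) ` rkhs k)"
        using L0 R0 lam by (intro bdd_belowI2[of _ 0]) (fastforce simp: rkhs_def)
      show "f' \<in> rkhs k" using f' by (auto simp: rkhs_def)
    qed
    also have "\<dots> \<le> 1 / 2 * L U f + lam / 2 * N fh"
      using f' R_le[OF f'(1)] lam by (intro add_mono mult_left_mono) auto
    finally show ?thesis .
  qed
  show ?thesis
    unfolding J[of U]
  proof (rule cINF_greatest[OF ne])
    fix f assume "f \<in> rkhs k"
    \<comment> \<open>For fixed \<open>f\<close> the bound holds for every density; isolating the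
      norm term allows the infimum over densities to be taken.\<close>
    have "(J_lin M X Y k lam U' - 1 / 2 * L U f) / (lam / 2) \<le> R f"
      unfolding R
    proof (rule cINF_greatest)
      show "{fh. fourier_rep k f fh} \<noteq> {}" using \<open>f \<in> rkhs k\<close> by (simp add: rkhs_def)
      fix fh assume "fh \<in> {fh. fourier_rep k f fh}"
      then show "(J_lin M X Y k lam U' - 1 / 2 * L U f) / (lam / 2) \<le> N fh"
        using J_le[of f fh] lam by (simp add: field_simps)
    qed
    then show "J_lin M X Y k lam U' \<le> 1 / 2 * L U f + lam / 2 * R f"
      using lam by (simp add: field_simps)
  qed
qed

text \<open>The density of a competitor for \<open>B\<close> is composed with the adjoint isometry
  \<open>L\<close>. Both \<open>k\<close> and Lebesgue measure are invariant under \<open>L\<close>,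
  so the norm term is kept, and \<open>f' (A *v x) = f (B *v x)\<close> keeps the loss. Exchanging
  \<open>A\<close> and \<open>B\<close> gives the reverse inequality, so the choice of root in
  \<open>J_form\<close> does not matter.\<close>

lemma J_lin_isometry:
  fixes C :: "real ^ 'n ^ 'n"
  assumes k: "\<And>\<omega>. k \<omega> > 0" and lam: "lam > 0"
    and C: "transpose C = C" "\<And>\<omega>. \<omega> \<noteq> 0 \<Longrightarrow> form_sq C \<omega> > 0"
    and k_rot: "\<And>\<omega>. k \<omega> = \<kappa> (form_sq C \<omega>)"
    and eq: "\<And>x. form_sq (matrix_inv C) (A *v x) = form_sq (matrix_inv C) (B *v x)"
  shows "J_lin M X Y k lam A \<le> J_lin M X Y k lam B"
proof (rule J_lin_mono[OF k lam])
  fix f fh assume rep: "fourier_rep k f fh"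
  obtain L L' :: "real ^ 'n ^ 'n" where L: "L ** L' = mat 1"
    "\<And>\<omega>. form_sq C (L *v \<omega>) = form_sq C \<omega>"
    "\<And>x \<omega>. (L *v \<omega>) \<bullet> (B *v x) = \<omega> \<bullet> (A *v x)"
    by (rule form_isometry_adjoint[OF C eq]) blast+
  have kL: "k (L *v \<omega>) = k \<omega>" for \<omega> by (simp add: k_rot L(2))
  note distr = distr_lborel_form_isometry[OF C L(1,2)]
  have [measurable]: "(*v) L \<in> borel_measurable borel"
    by (intro borel_measurable_continuous_onI continuous_intros)
  have fh[measurable]: "fh \<in> borel_measurable borel" using rep by (simp add: fourier_rep_def)
  have sub: "(LINT \<omega>|lborel. g (L *v \<omega>)) = (LINT \<omega>|lborel. g \<omega>)"
    if [measurable]: "g \<in> borel_measurable borel" for g :: "real ^ 'n \<Rightarrow> complex"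
    using integral_distr[of "(*v) L" lborel borel g] by (simp add: distr)
  have norm_int: "integrable lborel (\<lambda>\<omega>. (cmod (fh \<omega>))\<^sup>2 / k \<omega>)"
    using rep by (simp add: fourier_rep_def)
  then have [measurable]: "(\<lambda>\<omega>. (cmod (fh \<omega>))\<^sup>2 / k \<omega>) \<in> borel_measurable borel" by auto
  define fh' where "fh' \<omega> = fh (L *v \<omega>)" for \<omega>
  define f' where "f' x = (LINT \<omega>|lborel. fh' \<omega> * wave \<omega> x)" for x
  have norm_eq: "(\<lambda>\<omega>. (cmod (fh' \<omega>))\<^sup>2 / k \<omega>) = (\<lambda>\<omega>. (cmod (fh (L *v \<omega>)))\<^sup>2 / k (L *v \<omega>))"
    by (simp add: fh'_def kL)
  have "integrable lborel (\<lambda>\<omega>. (cmod (fh' \<omega>))\<^sup>2 / k \<omega>)"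
    unfolding norm_eq using norm_int
    by (subst integrable_distr_eq[of "(*v) L" lborel borel "\<lambda>\<omega>. (cmod (fh \<omega>))\<^sup>2 / k \<omega>", symmetric])
      (simp_all add: distr)
  then have "fourier_rep k f' fh'"
    by (auto simp: fourier_rep_def f'_def fh'_def[abs_def])
  moreover have "(LINT \<omega>|lborel. (cmod (fh' \<omega>))\<^sup>2 / k \<omega>) = (LINT \<omega>|lborel. (cmod (fh \<omega>))\<^sup>2 / k \<omega>)"
    unfolding norm_eq
    using integral_distr[of "(*v) L" lborel borel "\<lambda>\<omega>. (cmod (fh \<omega>))\<^sup>2 / k \<omega>"] by (simp add: distr)
  moreover have "f' (A *v x) = f (B *v x)" for x
  proof -
    have "f' (A *v x) = (LINT \<omega>|lborel. fh (L *v \<omega>) * wave (L *v \<omega>) (B *v x))"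
      unfolding f'_def fh'_def L(3) ..
    also have "\<dots> = (LINT \<omega>|lborel. fh \<omega> * wave \<omega> (B *v x))"
      by (rule sub) measurable
    also have "\<dots> = f (B *v x)" using rep by (simp add: fourier_rep_def)
    finally show ?thesis .
  qed
  ultimately show "\<exists>f' fh'. fourier_rep k f' fh' \<and>
      (LINT \<omega>|lborel. (cmod (fh' \<omega>))\<^sup>2 / k \<omega>) \<le> (LINT \<omega>|lborel. (cmod (fh \<omega>))\<^sup>2 / k \<omega>) \<and>
      (LINT p|M. (cmod (Y p - f' (A *v X p)))\<^sup>2) \<le> (LINT p|M. (cmod (Y p - f (B *v X p)))\<^sup>2)"
    by (intro exI[of _ f'] exI[of _ fh']) simp
qed

section \<open>The quadratic loss in terms of plane waves, and removal of noise\<close>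

lemma borel_measurable_cnj [measurable]: "cnj \<in> borel_measurable borel"
  by (intro borel_measurable_continuous_onI continuous_intros)

text \<open>Jensen's inequality for the square, obtained from the nonnegative variance of
  \<open>norm (g x)\<close>.\<close>

lemma (in prob_space) norm_expectation_sq_le:
  fixes g :: "'a \<Rightarrow> complex"
  assumes [measurable]: "g \<in> borel_measurable M" and bound: "\<And>x. norm (g x) \<le> B"
  shows "(norm (expectation g))\<^sup>2 \<le> expectation (\<lambda>x. (norm (g x))\<^sup>2)"
proof -
  have B: "0 \<le> B" using bound norm_ge_zero order_trans by blast
  have 1: "integrable M (\<lambda>x. norm (g x))"
    using bound by (intro integrable_const_bound[of _ B]) auto
  have 2: "integrable M (\<lambda>x. (norm (g x))\<^sup>2)"
    using bound B by (intro integrable_const_bound[of _ "B\<^sup>2"]) (auto intro!: power_mono)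
  have "norm (expectation g) \<le> expectation (\<lambda>x. norm (g x))"
    by (rule integral_norm_bound)
  then have "(norm (expectation g))\<^sup>2 \<le> (expectation (\<lambda>x. norm (g x)))\<^sup>2"
    by (intro power_mono) auto
  also have "\<dots> \<le> expectation (\<lambda>x. (norm (g x))\<^sup>2)"
    using variance_positive[of "\<lambda>x. norm (g x)"] variance_eq[OF 1 2] by simp
  finally show ?thesis .
qed

lemma (in prob_space) integrable_of_square:
  fixes Y :: "'a \<Rightarrow> complex"
  assumes [measurable]: "Y \<in> borel_measurable M" and "integrable M (\<lambda>p. (cmod (Y p))\<^sup>2)"
  shows "integrable M Y"
proof (rule Bochner_Integration.integrable_bound)
  show "integrable M (\<lambda>p. 1 + (cmod (Y p))\<^sup>2)" using assms(2) by simp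
  have "cmod (Y p) \<le> 1 + (cmod (Y p))\<^sup>2" for p
  proof -
    have "2 * cmod (Y p) \<le> 1 + (cmod (Y p))\<^sup>2"
      using zero_le_power2[of "cmod (Y p) - 1"] by (simp add: power2_diff)
    then show ?thesis using norm_ge_zero[of "Y p"] by linarith
  qed
  then show "AE p in M. norm (Y p) \<le> norm (1 + (cmod (Y p))\<^sup>2)" by simp
qed simp

text \<open>The quadratic term is written as \<open>cnj (Z p) * Z p\<close>, so that Fourier
  representations can be inserted for each factor in turn.\<close>

lemma (in prob_space) expectation_cmod_diff_sq:
  fixes Y Z :: "'a \<Rightarrow> complex"
  assumes Y: "Y \<in> borel_measurable M" "integrable M (\<lambda>p. (cmod (Y p))\<^sup>2)"
    and Z[measurable]: "Z \<in> borel_measurable M" and B: "\<And>p. norm (Z p) \<le> B"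
  shows "integrable M (\<lambda>p. (cmod (Y p - Z p))\<^sup>2)"
    and "expectation (\<lambda>p. (cmod (Y p - Z p))\<^sup>2) = expectation (\<lambda>p. (cmod (Y p))\<^sup>2)
      - 2 * Re (expectation (\<lambda>p. cnj (Y p) * Z p)) + Re (expectation (\<lambda>p. cnj (Z p) * Z p))"
proof -
  note Y(1)[measurable]
  have iY: "integrable M Y" using Y by (rule integrable_of_square)
  have B0: "0 \<le> B" using B norm_ge_zero order_trans by blast
  have YZ: "integrable M (\<lambda>p. cnj (Y p) * Z p)"
  proof (rule Bochner_Integration.integrable_bound)
    show "integrable M (\<lambda>p. of_real B * Y p)" using iY by simp
    have "norm (cnj (Y p) * Z p) \<le> norm (of_real B * Y p)" for p
      using mult_left_mono[OF B[of p], of "norm (Y p)"] B0 by (simp add: norm_mult mult.commute)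
    then show "AE p in M. norm (cnj (Y p) * Z p) \<le> norm (of_real B * Y p)" by simp
  qed simp
  have ZZ: "integrable M (\<lambda>p. cnj (Z p) * Z p)"
    using B B0 by (intro integrable_const_bound[of _ "B * B"]) (auto simp: norm_mult intro!: mult_mono)
  have eq: "(\<lambda>p. (cmod (Y p - Z p))\<^sup>2) =
      (\<lambda>p. (cmod (Y p))\<^sup>2 - 2 * Re (cnj (Y p) * Z p) + Re (cnj (Z p) * Z p))"
    unfolding cmod_power2 by (simp add: fun_eq_iff algebra_simps power2_eq_square)
  show "integrable M (\<lambda>p. (cmod (Y p - Z p))\<^sup>2)"
    unfolding eq using Y(2) integrable_Re[OF YZ] integrable_Re[OF ZZ]
    by (intro Bochner_Integration.integrable_add Bochner_Integration.integrable_diff integrable_mult_right)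
  show "expectation (\<lambda>p. (cmod (Y p - Z p))\<^sup>2) = expectation (\<lambda>p. (cmod (Y p))\<^sup>2)
      - 2 * Re (expectation (\<lambda>p. cnj (Y p) * Z p)) + Re (expectation (\<lambda>p. cnj (Z p) * Z p))"
    unfolding eq integral_Re[OF YZ, symmetric] integral_Re[OF ZZ, symmetric]
    using Y(2) integrable_Re[OF YZ] integrable_Re[OF ZZ]
    by (simp only: Bochner_Integration.integral_add Bochner_Integration.integral_diff
        Bochner_Integration.integrable_diff integrable_mult_right integral_mult_right_zero)
qed

text \<open>The representation is inserted twice, first with weight \<open>cnj (f (T p))\<close> and
  then with a plane wave as weight. The second moment of \<open>f (T p)\<close> is thereby
  determined by the characteristic function of \<open>T\<close>.\<close>

lemma integral_fourier_rep_sq: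
  fixes k :: "real ^ 'n \<Rightarrow> real" and T :: "'b \<Rightarrow> real ^ 'n"
  assumes k: "\<And>\<omega>. k \<omega> > 0" "integrable lborel k" and rep: "fourier_rep k f fh"
    and M: "prob_space M" and T[measurable]: "T \<in> borel_measurable M"
  shows "(LINT p|M. cnj (f (T p)) * f (T p)) =
    (LINT \<omega>|lborel. fh \<omega> * cnj (LINT \<eta>|lborel. fh \<eta> * (LINT p|M. wave (\<eta> - \<omega>) (T p))))"
proof -
  interpret M: prob_space M by fact
  note f = fourier_rep_bounded_measurable[OF k rep]
  note f(1)[measurable]
  have "integrable M (\<lambda>p. cnj (f (T p)))"
    using f(2) by (intro M.integrable_const_bound) (auto intro!: AE_I2)
  then have "(LINT p|M. cnj (f (T p)) * f (T p)) =
      (LINT \<omega>|lborel. fh \<omega> * (LINT p|M. cnj (f (T p)) * wave \<omega> (T p)))"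
    by (rule integral_fourier_rep[OF k rep M T])
  also have "(\<lambda>\<omega>. LINT p|M. cnj (f (T p)) * wave \<omega> (T p)) =
      (\<lambda>\<omega>. cnj (LINT \<eta>|lborel. fh \<eta> * (LINT p|M. wave (\<eta> - \<omega>) (T p))))"
  proof
    fix \<omega>
    have "integrable M (\<lambda>p. wave (- \<omega>) (T p))"
      by (intro M.integrable_const_bound[of _ 1]) (auto simp: norm_exp_eq_Re)
    then have *: "(LINT p|M. wave (- \<omega>) (T p) * f (T p)) =
        (LINT \<eta>|lborel. fh \<eta> * (LINT p|M. wave (- \<omega>) (T p) * wave \<eta> (T p)))"
      by (rule integral_fourier_rep[OF k rep M T])
    have **: "wave (- \<omega>) x * wave \<eta> x = wave (\<eta> - \<omega>) x" for \<eta> x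
      by (simp add: inner_diff_left algebra_simps flip: exp_add)
    have "cnj (f x) * wave \<omega> x = cnj (wave (- \<omega>) x * f x)" for x
      by (simp add: exp_cnj)
    then have "(LINT p|M. cnj (f (T p)) * wave \<omega> (T p)) = cnj (LINT p|M. wave (- \<omega>) (T p) * f (T p))"
      by (simp only: Bochner_Integration.integral_cnj)
    then show "(LINT p|M. cnj (f (T p)) * wave \<omega> (T p)) =
      cnj (LINT \<eta>|lborel. fh \<eta> * (LINT p|M. wave (\<eta> - \<omega>) (T p)))"
      unfolding * ** .
  qed
  finally show ?thesis .
qed

text \<open>After expansion, the loss depends on \<open>T\<close> and \<open>Y\<close> only through
  the second moment of \<open>Y\<close> and the expectations of plane waves, plain and weighted by
  \<open>cnj (Y p)\<close>. The two sides may live on different probability spaces, which allows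
  noise to be added on a product space.\<close>

lemma loss_eq_of_wave_expectations:
  fixes k :: "real ^ 'n \<Rightarrow> real" and T :: "'b \<Rightarrow> real ^ 'n" and T' :: "'c \<Rightarrow> real ^ 'n"
  assumes k: "\<And>\<omega>. k \<omega> > 0" "integrable lborel k" and rep: "fourier_rep k f fh"
    and M: "prob_space M" "T \<in> borel_measurable M" "Y \<in> borel_measurable M"
      "integrable M (\<lambda>p. (cmod (Y p))\<^sup>2)"
    and M': "prob_space M'" "T' \<in> borel_measurable M'" "Y' \<in> borel_measurable M'"
      "integrable M' (\<lambda>p. (cmod (Y' p))\<^sup>2)"
    and eq: "(LINT p|M. (cmod (Y p))\<^sup>2) = (LINT p|M'. (cmod (Y' p))\<^sup>2)"
      "\<And>\<omega>. (LINT p|M. wave \<omega> (T p)) = (LINT p|M'. wave \<omega> (T' p))"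
      "\<And>\<omega>. (LINT p|M. cnj (Y p) * wave \<omega> (T p)) = (LINT p|M'. cnj (Y' p) * wave \<omega> (T' p))"
  shows "(LINT p|M. (cmod (Y p - f (T p)))\<^sup>2) = (LINT p|M'. (cmod (Y' p - f (T' p)))\<^sup>2)"
proof -
  note f = fourier_rep_bounded_measurable[OF k rep]
  note f(1)[measurable] M(2)[measurable] M'(2)[measurable]
  have expand: "(LINT p|M. (cmod (Y p - f (T p)))\<^sup>2) = (LINT p|M. (cmod (Y p))\<^sup>2)
      - 2 * Re (LINT \<omega>|lborel. fh \<omega> * (LINT p|M. cnj (Y p) * wave \<omega> (T p)))
      + Re (LINT \<omega>|lborel. fh \<omega> * cnj (LINT \<eta>|lborel. fh \<eta> * (LINT p|M. wave (\<eta> - \<omega>) (T p))))"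
    if M: "prob_space M" "T \<in> borel_measurable M" "Y \<in> borel_measurable M"
      "integrable M (\<lambda>p. (cmod (Y p))\<^sup>2)"
    for M :: "'d measure" and T :: "'d \<Rightarrow> real ^ 'n" and Y
  proof -
    note M(2)[measurable]
    have "integrable M (\<lambda>p. cnj (Y p))"
      using prob_space.integrable_of_square[OF M(1,3,4)] by simp
    from integral_fourier_rep[OF k rep M(1,2) this] integral_fourier_rep_sq[OF k rep M(1,2)]
    show ?thesis
      by (subst prob_space.expectation_cmod_diff_sq(2)[OF M(1,3,4) _ f(2)]) simp_all
  qed
  show ?thesis
    unfolding expand[OF M] expand[OF M'] eq ..
qed

text \<open>If \<open>U X\<close> has the law of \<open>U' X\<close> plus independent noise \<open>v\<close>, then averaging a competitor
  for \<open>U\<close> over the noise gives a competitor for \<open>U'\<close> that is at least as good: on the Fourier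
  side the average is multiplication by the characteristic function of \<open>v\<close>, and the loss
  decreases by Jensen's inequality.\<close>
lemma J_lin_noise_removal:
  fixes k :: "real ^ 'n \<Rightarrow> real" and X :: "'a \<Rightarrow> real ^ 'n" and U U' :: "real ^ 'n ^ 'n"
    and v :: "'b \<Rightarrow> real ^ 'n"
  assumes k: "\<And>\<omega>. k \<omega> > 0" "integrable lborel k" and lam: "lam > 0"
    and M: "prob_space M" and X: "X \<in> borel_measurable M"
    and Y: "Y \<in> borel_measurable M" "integrable M (\<lambda>p. (cmod (Y p))\<^sup>2)"
    and N: "prob_space N" and v: "v \<in> borel_measurable N"
    and char: "\<And>\<omega>. (LINT p|M. wave \<omega> (U *v X p)) =
      (LINT p|M. wave \<omega> (U' *v X p)) * (LINT u|N. wave \<omega> (v u))"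
    and charY: "\<And>\<omega>. (LINT p|M. cnj (Y p) * wave \<omega> (U *v X p)) =
      (LINT p|M. cnj (Y p) * wave \<omega> (U' *v X p)) * (LINT u|N. wave \<omega> (v u))"
  shows "J_lin M X Y k lam U' \<le> J_lin M X Y k lam U"
proof (rule J_lin_mono[OF k(1) lam])
  fix f fh assume rep: "fourier_rep k f fh"
  note f = fourier_rep_bounded_measurable[OF k rep]
  define B where "B = (LINT \<omega>|lborel. norm (fh \<omega>))"
  have fB: "norm (f x) \<le> B" for x using f(2) by (simp add: B_def)
  interpret M: prob_space M by fact
  interpret N: prob_space N by fact
  interpret P: pair_prob_space M N ..
  note X[measurable] v[measurable] Y(1)[measurable] f(1)[measurable]
  have cont: "(\<lambda>x. A *v x) \<in> borel_measurable borel" for A :: "real ^ 'n ^ 'n"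
    by (intro borel_measurable_continuous_onI continuous_intros)
  have [measurable]: "(\<lambda>p. A *v X p) \<in> borel_measurable M" for A :: "real ^ 'n ^ 'n"
    using measurable_compose[OF X cont[of A]] .
  have fh[measurable]: "fh \<in> borel_measurable borel" using rep by (simp add: fourier_rep_def)
  \<comment> \<open>The characteristic function of the noise. It is bounded by 1, so multiplying a
    density by it cannot increase the weighted norm.\<close>
  define \<psi> where "\<psi> \<omega> = (LINT u|N. wave \<omega> (v u))" for \<omega>
  have \<psi>_meas[measurable]: "\<psi> \<in> borel_measurable borel"
    unfolding \<psi>_def[abs_def] by measurable
  have \<psi>1: "cmod (\<psi> \<omega>) \<le> 1" for \<omega>
    unfolding \<psi>_def by (rule order_trans[OF integral_norm_bound]) (simp add: norm_wave N.prob_space)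
  define fh' where "fh' \<omega> = fh \<omega> * \<psi> \<omega>" for \<omega>
  define f' where "f' y = (LINT u|N. f (y + v u))" for y
  have k_meas[measurable]: "k \<in> borel_measurable borel" using k(2) by auto
  have int: "integrable lborel (\<lambda>\<omega>. (cmod (fh \<omega>))\<^sup>2 / k \<omega>)" using rep by (simp add: fourier_rep_def)
  have le: "(cmod (fh' \<omega>))\<^sup>2 / k \<omega> \<le> (cmod (fh \<omega>))\<^sup>2 / k \<omega>" for \<omega>
  proof -
    have "cmod (fh' \<omega>) \<le> cmod (fh \<omega>) * 1"
      unfolding fh'_def norm_mult using \<psi>1 by (intro mult_left_mono) auto
    then show ?thesis using k(1)[of \<omega>] by (intro divide_right_mono power_mono) auto
  qed
  have int': "integrable lborel (\<lambda>\<omega>. (cmod (fh' \<omega>))\<^sup>2 / k \<omega>)"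
    using int
  proof (rule Bochner_Integration.integrable_bound)
    show "AE \<omega> in lborel. norm ((cmod (fh' \<omega>))\<^sup>2 / k \<omega>) \<le> norm ((cmod (fh \<omega>))\<^sup>2 / k \<omega>)"
      using le k(1) by (simp add: less_imp_le)
  qed (simp add: fh'_def)
  have "f' y = (LINT \<omega>|lborel. fh' \<omega> * wave \<omega> y)" for y
  proof -
    have "f' y = (LINT u|N. 1 * f (y + v u))" by (simp add: f'_def)
    also have "\<dots> = (LINT \<omega>|lborel. fh \<omega> * (LINT u|N. 1 * wave \<omega> (y + v u)))"
      by (rule integral_fourier_rep[OF k rep N]) simp_all
    also have "(\<lambda>\<omega>. LINT u|N. 1 * wave \<omega> (y + v u)) = (\<lambda>\<omega>. \<psi> \<omega> * wave \<omega> y)"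
      unfolding wave_add by (simp add: \<psi>_def mult.commute)
    finally show ?thesis by (simp add: fh'_def mult.assoc)
  qed
  then have rep': "fourier_rep k f' fh'"
    using int' by (auto simp: fourier_rep_def fh'_def[abs_def])
  \<comment> \<open>The product space carries the noise independently of \<open>X\<close> and
    \<open>Y\<close>. There \<open>T\<close> has the same plane wave expectations as
    \<open>U *v X p\<close>, also when weighted with \<open>cnj (Y p)\<close>.\<close>
  define T where "T = (\<lambda>(p, u). U' *v X p + v u)"
  define Y' where "Y' = (\<lambda>(p :: 'a, u :: 'b). Y p)"
  have T[measurable]: "T \<in> borel_measurable (M \<Otimes>\<^sub>M N)"
    unfolding T_def by measurable
  have Y'[measurable]: "Y' \<in> borel_measurable (M \<Otimes>\<^sub>M N)"
    unfolding Y'_def by measurable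
  have fst: "distr (M \<Otimes>\<^sub>M N) M fst = M"
    by (rule N.distr_pair_fst)
  have int_fst: "integrable (M \<Otimes>\<^sub>M N) (\<lambda>z. g (fst z))" if "integrable M g"
    for g :: "'a \<Rightarrow> 'c::{banach, second_countable_topology}"
  proof -
    have "integrable (distr (M \<Otimes>\<^sub>M N) M fst) g" using that by (simp add: fst)
    then show ?thesis by (rule integrable_distr[rotated]) simp
  qed
  have Y'2: "integrable (M \<Otimes>\<^sub>M N) (\<lambda>z. (cmod (Y' z))\<^sup>2)"
    using int_fst[OF Y(2)] by (simp add: Y'_def case_prod_beta)
  have Y'_norm: "(LINT z|(M \<Otimes>\<^sub>M N). (cmod (Y' z))\<^sup>2) = (LINT p|M. (cmod (Y p))\<^sup>2)"
    using integral_distr[of fst "M \<Otimes>\<^sub>M N" M "\<lambda>p. (cmod (Y p))\<^sup>2"]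
    by (simp add: fst Y'_def case_prod_beta)
  have prod: "(LINT z|(M \<Otimes>\<^sub>M N). g (fst z) * wave \<omega> (T z)) =
      (LINT p|M. g p * wave \<omega> (U' *v X p)) * \<psi> \<omega>" if g: "integrable M g" for g \<omega>
  proof -
    note g[THEN borel_measurable_integrable, measurable]
    have "integrable (M \<Otimes>\<^sub>M N) (\<lambda>z. g (fst z) * wave \<omega> (T z))"
      using int_fst[OF g] by (rule Bochner_Integration.integrable_bound) (auto simp: norm_mult norm_wave)
    from P.integral_fst'[OF this, symmetric]
    have "(LINT z|(M \<Otimes>\<^sub>M N). g (fst z) * wave \<omega> (T z)) =
        (LINT p|M. LINT u|N. g p * (wave \<omega> (U' *v X p) * wave \<omega> (v u)))"
      by (simp only: T_def case_prod_conv fst_conv wave_add)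
    also have "\<dots> = (LINT p|M. (g p * wave \<omega> (U' *v X p)) * \<psi> \<omega>)"
      by (simp add: \<psi>_def mult.assoc[symmetric])
    also have "\<dots> = (LINT p|M. g p * wave \<omega> (U' *v X p)) * \<psi> \<omega>"
      by simp
    finally show ?thesis .
  qed
  have intY: "integrable M (\<lambda>p. cnj (Y p))"
    using M.integrable_of_square[OF Y] by simp
  have "(LINT p|M. (cmod (Y p - f (U *v X p)))\<^sup>2) = (LINT z|(M \<Otimes>\<^sub>M N). (cmod (Y' z - f (T z)))\<^sup>2)"
  proof (rule loss_eq_of_wave_expectations[OF k rep M _ Y P.prob_space_axioms T Y' Y'2 Y'_norm[symmetric]])
    fix \<omega>
    show "(LINT p|M. wave \<omega> (U *v X p)) = (LINT z|(M \<Otimes>\<^sub>M N). wave \<omega> (T z))"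
      using prod[of "\<lambda>_. 1" \<omega>] char[of \<omega>] by (simp add: \<psi>_def)
    show "(LINT p|M. cnj (Y p) * wave \<omega> (U *v X p)) = (LINT z|(M \<Otimes>\<^sub>M N). cnj (Y' z) * wave \<omega> (T z))"
      using prod[OF intY, of \<omega>] charY[of \<omega>] by (simp add: \<psi>_def Y'_def case_prod_beta)
  qed simp
  moreover have "(LINT p|M. (cmod (Y p - f' (U' *v X p)))\<^sup>2) \<le> (LINT z|(M \<Otimes>\<^sub>M N). (cmod (Y' z - f (T z)))\<^sup>2)"
  proof -
    have int2: "integrable (M \<Otimes>\<^sub>M N) (\<lambda>z. (cmod (Y' z - f (T z)))\<^sup>2)"
      using Y'2 fB by (intro P.expectation_cmod_diff_sq(1)) simp_all
    \<comment> \<open>For fixed \<open>p\<close> the response is constant in \<open>u\<close>, so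
      the residual of the averaged competitor is the average of the residuals.\<close>
    have jensen: "(cmod (Y p - f' (U' *v X p)))\<^sup>2 \<le> (LINT u|N. (cmod (Y' (p, u) - f (T (p, u))))\<^sup>2)" for p
    proof -
      have "integrable N (\<lambda>u. f (U' *v X p + v u))"
        using fB by (intro N.integrable_const_bound[of _ B]) auto
      then have "Y p - f' (U' *v X p) = (LINT u|N. Y p - f (U' *v X p + v u))"
        by (simp add: f'_def N.prob_space)
      also have "(cmod \<dots>)\<^sup>2 \<le> (LINT u|N. (cmod (Y p - f (U' *v X p + v u)))\<^sup>2)"
      proof (rule N.norm_expectation_sq_le[of _ "cmod (Y p) + B"])
        show "cmod (Y p - f (U' *v X p + v u)) \<le> cmod (Y p) + B" for u
          using norm_triangle_ineq4[of "Y p" "f (U' *v X p + v u)"] fB[of "U' *v X p + v u"] by linarith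
      qed simp
      finally show ?thesis by (simp add: Y'_def T_def)
    qed
    have f'_meas[measurable]: "f' \<in> borel_measurable borel"
      and f'B: "\<And>x. norm (f' x) \<le> (LINT \<omega>|lborel. norm (fh' \<omega>))"
      using fourier_rep_bounded_measurable[OF k rep'] by auto
    have "(LINT p|M. (cmod (Y p - f' (U' *v X p)))\<^sup>2) \<le>
        (LINT p|M. LINT u|N. (cmod (Y' (p, u) - f (T (p, u))))\<^sup>2)"
      using jensen P.integrable_fst'[OF int2] f'B Y
      by (intro integral_mono M.expectation_cmod_diff_sq(1)) simp_all
    also have "\<dots> = (LINT z|(M \<Otimes>\<^sub>M N). (cmod (Y' z - f (T z)))\<^sup>2)"
      by (rule P.integral_fst'[OF int2])
    finally show ?thesis .
  qed
  moreover have "(LINT \<omega>|lborel. (cmod (fh' \<omega>))\<^sup>2 / k \<omega>) \<le> (LINT \<omega>|lborel. (cmod (fh \<omega>))\<^sup>2 / k \<omega>)"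
    using int int' le by (intro integral_mono)
  ultimately show "\<exists>f' fh'. fourier_rep k f' fh' \<and>
      (LINT \<omega>|lborel. (cmod (fh' \<omega>))\<^sup>2 / k \<omega>) \<le> (LINT \<omega>|lborel. (cmod (fh \<omega>))\<^sup>2 / k \<omega>) \<and>
      (LINT p|M. (cmod (Y p - f' (U' *v X p)))\<^sup>2) \<le> (LINT p|M. (cmod (Y p - f (U *v X p)))\<^sup>2)"
    using rep' by (intro exI[of _ f'] exI[of _ fh']) simp
qed

section \<open>Gaussian components\<close>

lemma integral_std_normal_iexp:
  "(LINT u|std_normal_distribution. iexp (t * u)) = complex_of_real (exp (- (t\<^sup>2) / 2))"
  using fun_cong[OF char_std_normal_distribution, of t] by (simp add: char_def)

text \<open>For positive variance the functional is standardised, which reduces the claim to the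
  standard normal law. For variance zero it is almost surely constant and the exponential factor is
  1.\<close>

lemma gaussian_vector_char:
  assumes M: "prob_space M" and g: "gaussian_vector M Z m Q" and nonneg: "0 \<le> form_sq Q \<eta>"
  shows "(LINT p|M. iexp (\<eta> \<bullet> Z p)) = iexp (\<eta> \<bullet> m) * of_real (exp (- form_sq Q \<eta> / 2))"
proof -
  interpret prob_space M by fact
  have [measurable]: "Z \<in> borel_measurable M" using g by (simp add: gaussian_vector_def)
  have law: "if form_sq Q \<eta> = 0 then AE p in M. \<eta> \<bullet> Z p = \<eta> \<bullet> m
      else distributed M lborel (\<lambda>p. \<eta> \<bullet> Z p) (normal_density (\<eta> \<bullet> m) (form_norm Q \<eta>))"
    using g unfolding gaussian_vector_def by blast
  show ?thesis
  proof (cases "form_sq Q \<eta> = 0")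
    case True
    then have "AE p in M. \<eta> \<bullet> Z p = \<eta> \<bullet> m"
      using law by simp
    then have "(LINT p|M. iexp (\<eta> \<bullet> Z p)) = (LINT p|M. iexp (\<eta> \<bullet> m))"
      by (intro integral_cong_AE) (auto elim!: eventually_mono)
    then show ?thesis using True by (simp add: prob_space)
  next
    case False
    define \<sigma> where "\<sigma> = form_norm Q \<eta>"
    have \<sigma>: "\<sigma> > 0" "\<sigma>\<^sup>2 = form_sq Q \<eta>"
      using False nonneg by (auto simp: \<sigma>_def form_norm_def)
    define N where "N p = (\<eta> \<bullet> Z p - \<eta> \<bullet> m) / \<sigma>" for p
    have [measurable]: "N \<in> borel_measurable M" unfolding N_def by measurable
    have "distributed M lborel (\<lambda>p. \<eta> \<bullet> Z p) (normal_density (\<eta> \<bullet> m) \<sigma>)"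
      using law False unfolding \<sigma>_def by (simp only: if_False)
    then have "distributed M lborel N std_normal_density"
      unfolding N_def normal_standard_normal_convert[OF \<sigma>(1)] .
    then have std: "distr M lborel N = std_normal_distribution"
      by (rule distributed_distr_eq_density)
    have "(LINT p|M. iexp (\<eta> \<bullet> Z p)) = (LINT p|M. iexp (\<eta> \<bullet> m) * iexp (\<sigma> * N p))"
    proof -
      have "\<sigma> * N p = \<eta> \<bullet> Z p - \<eta> \<bullet> m" for p using \<sigma>(1) by (simp add: N_def)
      then show ?thesis by (simp add: right_diff_distrib flip: exp_add)
    qed
    also have "\<dots> = iexp (\<eta> \<bullet> m) * (LINT p|M. iexp (\<sigma> * N p))"
      by simp
    also have "(LINT p|M. iexp (\<sigma> * N p)) = (LINT u|distr M lborel N. iexp (\<sigma> * u))"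
      by (rule integral_distr[symmetric]) auto
    finally show ?thesis unfolding std integral_std_normal_iexp \<sigma>(2) .
  qed
qed

text \<open>The defining property of conditional expectation, tested against bounded complex
  functions of \<open>X\<close>; it follows from the real case applied to real and imaginary
  parts.\<close>

lemma complex_cond_exp_integral:
  fixes X :: "'a \<Rightarrow> real ^ 'n" and \<phi> :: "real ^ 'n \<Rightarrow> complex"
  assumes M: "prob_space M" and X[measurable]: "X \<in> borel_measurable M" and Y: "integrable M Y"
    and \<phi>[measurable]: "\<phi> \<in> borel_measurable borel" and B: "\<And>x. norm (\<phi> x) \<le> B"
  defines "F \<equiv> vimage_algebra (space M) X borel"
  shows "integrable M (complex_cond_exp M F Y)"
    and "(LINT p|M. Y p * \<phi> (X p)) = (LINT p|M. complex_cond_exp M F Y p * \<phi> (X p))"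
proof -
  interpret prob_space M by fact
  have "subalgebra M F"
    unfolding subalgebra_def F_def using measurable_sets[OF X] by (auto simp: sets_vimage_algebra2)
  then interpret finite_measure_subalgebra M F
    by unfold_locales
  have XF[measurable]: "X \<in> borel_measurable F"
    unfolding F_def by (rule measurable_vimage_algebra1) simp
  define a b where "a = real_cond_exp M F (\<lambda>q. Re (Y q))" and "b = real_cond_exp M F (\<lambda>q. Im (Y q))"
  have Ym[measurable]: "Y \<in> borel_measurable M" using Y by auto
  have ReY: "integrable M (\<lambda>q. Re (Y q))" and ImY: "integrable M (\<lambda>q. Im (Y q))" using Y by auto
  have ab: "integrable M a" "integrable M b"
    unfolding a_def b_def using real_cond_exp_int(1) ReY ImY by auto
  have ce: "complex_cond_exp M F Y p = of_real (a p) + \<i> * of_real (b p)" for p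
    by (simp add: complex_cond_exp_def a_def b_def complex_eq_iff)
  show int: "integrable M (complex_cond_exp M F Y)"
    unfolding ce[abs_def] using ab by simp
  have B0: "0 \<le> B" using B norm_ge_zero order_trans by blast
  have real: "(LINT p|M. r (X p) * real_cond_exp M F y p) = (LINT p|M. r (X p) * y p)"
    and real_int: "integrable M (\<lambda>p. r (X p) * y p)" "integrable M (\<lambda>p. r (X p) * real_cond_exp M F y p)"
    if y: "integrable M y" and [measurable]: "r \<in> borel_measurable borel" and r: "\<And>x. \<bar>r x\<bar> \<le> B"
    for r y
  proof -
    have [measurable]: "y \<in> borel_measurable M" using y by auto
    show i: "integrable M (\<lambda>p. r (X p) * y p)"
    proof (rule Bochner_Integration.integrable_bound)
      show "integrable M (\<lambda>p. B * y p)" using y by simp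
      show "AE p in M. norm (r (X p) * y p) \<le> norm (B * y p)"
        using r B0 by (auto simp: abs_mult intro!: mult_right_mono)
    qed simp
    show "(LINT p|M. r (X p) * real_cond_exp M F y p) = (LINT p|M. r (X p) * y p)"
      "integrable M (\<lambda>p. r (X p) * real_cond_exp M F y p)"
      by (rule real_cond_exp_intg[OF i]; simp)+
  qed
  have Re: "\<bar>Re (\<phi> x)\<bar> \<le> B" and Im: "\<bar>Im (\<phi> x)\<bar> \<le> B" for x
    using abs_Re_le_cmod[of "\<phi> x"] abs_Im_le_cmod[of "\<phi> x"] B[of x] by linarith+
  \<comment> \<open>The product is expanded into four real integrals. The same expansion serves for
    \<open>Y\<close> and for its conditional expectation, and these agree term by term.\<close>
  have split: "(LINT p|M. (of_real (c p) + \<i> * of_real (d p)) * \<phi> (X p)) =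
      Complex ((LINT p|M. Re (\<phi> (X p)) * c p) - (LINT p|M. Im (\<phi> (X p)) * d p))
        ((LINT p|M. Im (\<phi> (X p)) * c p) + (LINT p|M. Re (\<phi> (X p)) * d p))"
    if "integrable M c" "integrable M d" for c d
  proof -
    note i = real_int(1)[OF that(1), of "\<lambda>x. Re (\<phi> x)"] real_int(1)[OF that(2), of "\<lambda>x. Im (\<phi> x)"]
      real_int(1)[OF that(1), of "\<lambda>x. Im (\<phi> x)"] real_int(1)[OF that(2), of "\<lambda>x. Re (\<phi> x)"]
    have eq: "(of_real (c p) + \<i> * of_real (d p)) * \<phi> (X p) =
        of_real (Re (\<phi> (X p)) * c p - Im (\<phi> (X p)) * d p)
        + \<i> * of_real (Im (\<phi> (X p)) * c p + Re (\<phi> (X p)) * d p)" for p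
      by (simp add: complex_eq_iff algebra_simps)
    have i1: "integrable M (\<lambda>p. Re (\<phi> (X p)) * c p - Im (\<phi> (X p)) * d p)"
      using i Re Im by (intro Bochner_Integration.integrable_diff) simp_all
    have i2: "integrable M (\<lambda>p. Im (\<phi> (X p)) * c p + Re (\<phi> (X p)) * d p)"
      using i Re Im by (intro Bochner_Integration.integrable_add) simp_all
    have "(LINT p|M. (of_real (c p) + \<i> * of_real (d p)) * \<phi> (X p)) =
      of_real (LINT p|M. Re (\<phi> (X p)) * c p - Im (\<phi> (X p)) * d p)
        + \<i> * of_real (LINT p|M. Im (\<phi> (X p)) * c p + Re (\<phi> (X p)) * d p)"
      unfolding eq using i1 i2
      by (subst Bochner_Integration.integral_add) (simp_all only: integrable_of_real integrable_mult_right
          integral_mult_right_zero integral_complex_of_real)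
    then show ?thesis
      using i Re Im by (simp add: complex_eq_iff)
  qed
  have "(LINT p|M. Y p * \<phi> (X p)) = (LINT p|M. (of_real (Re (Y p)) + \<i> * of_real (Im (Y p))) * \<phi> (X p))"
    by (simp flip: complex_eq)
  also have "\<dots> = (LINT p|M. (of_real (a p) + \<i> * of_real (b p)) * \<phi> (X p))"
    unfolding split[OF ReY ImY] split[OF ab]
    unfolding a_def b_def
    using real[OF ReY, of "\<lambda>x. Re (\<phi> x)"] real[OF ReY, of "\<lambda>x. Im (\<phi> x)"]
      real[OF ImY, of "\<lambda>x. Re (\<phi> x)"] real[OF ImY, of "\<lambda>x. Im (\<phi> x)"] Re Im by simp
  finally show "(LINT p|M. Y p * \<phi> (X p)) = (LINT p|M. complex_cond_exp M F Y p * \<phi> (X p))"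
    by (simp only: ce)
qed

section \<open>Covariance and independence of the components\<close>

lemma inner_covariance:
  fixes Z :: "'a \<Rightarrow> real ^ 'n"
  assumes M: "prob_space M" and Z: "integrable M Z" "integrable M (\<lambda>p. (norm (Z p))\<^sup>2)"
  defines "Zc \<equiv> \<lambda>p. Z p - integral\<^sup>L M Z"
  shows "integrable M (\<lambda>p. (a \<bullet> Zc p) * (b \<bullet> Zc p))"
    and "a \<bullet> (covariance M Z *v b) = (LINT p|M. (a \<bullet> Zc p) * (b \<bullet> Zc p))"
proof -
  interpret prob_space M by fact
  have [measurable]: "Z \<in> borel_measurable M" using Z by auto
  have [measurable]: "Zc \<in> borel_measurable M" unfolding Zc_def by measurable
  have "(norm (Zc p))\<^sup>2 = (norm (Z p))\<^sup>2 - 2 * (Z p \<bullet> integral\<^sup>L M Z) + (norm (integral\<^sup>L M Z))\<^sup>2" for p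
    unfolding Zc_def power2_norm_eq_inner by (simp add: inner_diff_left inner_diff_right inner_commute)
  then have sq: "integrable M (\<lambda>p. (norm (Zc p))\<^sup>2)" using Z by simp
  show int: "integrable M (\<lambda>p. (a \<bullet> Zc p) * (b \<bullet> Zc p))" for a b
  proof (rule Bochner_Integration.integrable_bound)
    show "integrable M (\<lambda>p. (norm a * norm b) * (norm (Zc p))\<^sup>2)" using sq by simp
    have "\<bar>(a \<bullet> Zc p) * (b \<bullet> Zc p)\<bar> \<le> (norm a * norm (Zc p)) * (norm b * norm (Zc p))" for p
      unfolding abs_mult by (intro mult_mono Cauchy_Schwarz_ineq2) auto
    then show "AE p in M. norm ((a \<bullet> Zc p) * (b \<bullet> Zc p)) \<le> norm ((norm a * norm b) * (norm (Zc p))\<^sup>2)"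
      by (simp add: power2_eq_square ac_simps abs_mult)
  qed simp
  have ij: "integrable M (\<lambda>p. Zc p $ i * Zc p $ j)" for i j
    using int[of "axis i 1" "axis j 1"] by (simp add: inner_axis')
  have "(LINT p|M. (a \<bullet> Zc p) * (b \<bullet> Zc p)) =
      (LINT p|M. (\<Sum>i\<in>UNIV. \<Sum>j\<in>UNIV. (a $ i * b $ j) * (Zc p $ i * Zc p $ j)))"
    by (simp add: inner_vec_def sum_product ac_simps)
  also have "\<dots> = (\<Sum>i\<in>UNIV. \<Sum>j\<in>UNIV. (a $ i * b $ j) * (LINT p|M. Zc p $ i * Zc p $ j))"
    using ij by (simp add: Bochner_Integration.integral_sum)
  also have "\<dots> = a \<bullet> (covariance M Z *v b)"
    by (simp add: covariance_def Zc_def inner_vec_def matrix_vector_mult_def sum_distrib_left ac_simps)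
  finally show "a \<bullet> (covariance M Z *v b) = (LINT p|M. (a \<bullet> Zc p) * (b \<bullet> Zc p))" by simp
qed

lemma transpose_covariance: "transpose (covariance M Z) = covariance M Z"
  by (simp add: covariance_def transpose_def vec_eq_iff mult.commute)

lemma form_sq_covariance_nonneg:
  assumes "prob_space M" "integrable M Z" "integrable M (\<lambda>p. (norm (Z p))\<^sup>2)"
  shows "0 \<le> form_sq (covariance M Z) a"
  unfolding form_sq_def inner_covariance(2)[OF assms] by simp

text \<open>Independence makes the covariance block diagonal for the decomposition, so its inverse
  maps \<open>W\<close> into the functionals that vanish on \<open>W'\<close>. Hence \<theta> sees
  only the Gaussian component, and the covariance of that component also maps \<theta> to
  \<open>w\<close>.\<close>

lemma covariance_independent_components:
  fixes X :: "'a \<Rightarrow> real ^ 'n"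
  assumes M: "prob_space M" and X: "integrable M X" "integrable M (\<lambda>p. (norm (X p))\<^sup>2)"
    and cov_pos: "\<And>\<omega>. \<omega> \<noteq> 0 \<Longrightarrow> form_sq (covariance M X) \<omega> > 0"
    and d: "direct_sum_decomp W W'"
    and indep: "prob_space.indep_var M borel (\<lambda>p. component W W' (X p))
                  borel (\<lambda>p. component W' W (X p))"
    and w: "w \<in> W" and \<theta>: "covariance M X *v \<theta> = w"
  shows "\<theta> \<bullet> component W' W x = 0"
    and "\<eta> \<bullet> (covariance M (\<lambda>p. component W W' (X p)) *v \<theta>) = \<eta> \<bullet> w"
    and "integrable M (\<lambda>p. component W W' (X p))"
    and "integrable M (\<lambda>p. (norm (component W W' (X p)))\<^sup>2)"
proof -
  interpret prob_space M by fact
  define P P' where "P = component W W'" and "P' = component W' W"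
  have lin: "linear P" "linear P'"
    unfolding P_def P'_def using d direct_sum_decomp_commute linear_component by blast+
  have bl: "bounded_linear P" "bounded_linear P'"
    using lin by (simp_all add: linear_conv_bounded_linear)
  have sum: "P x + P' x = x" for x using component_add[OF d] by (simp add: P_def P'_def)
  have split: "a \<bullet> x = a \<bullet> P x + a \<bullet> P' x" for a x
    by (subst sum[of x, symmetric]) (rule inner_add_right)
  have Pw: "P w = w" "P' w = 0" using component_id[OF d w] component_null[OF d w] by (simp_all add: P_def P'_def)
  have [measurable]: "X \<in> borel_measurable M" using X by auto
  define Xc where "Xc p = X p - integral\<^sup>L M X" for p
  have Xc_int: "integrable M Xc" unfolding Xc_def using X(1) by simp
  have Xc0: "integral\<^sup>L M Xc = 0" unfolding Xc_def using X(1) by (simp add: prob_space)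
  note B = inner_covariance[OF M X, folded Xc_def]
  \<comment> \<open>The adjoint for the coordinate pairing is the pullback of functionals along the
    projection.\<close>
  have adj: "adjoint P a \<bullet> x = a \<bullet> P x" "adjoint P' a \<bullet> x = a \<bullet> P' x" for a x
    using adjoint_works[OF lin(1)] adjoint_works[OF lin(2)] by (simp_all add: inner_commute)
  have int: "integrable M (\<lambda>p. (a \<bullet> P (Xc p)) * (b \<bullet> P' (Xc p)))"
    "integrable M (\<lambda>p. (a \<bullet> P' (Xc p)) * (b \<bullet> P' (Xc p)))" for a b
    using B(1)[of "adjoint P a" "adjoint P' b"] B(1)[of "adjoint P' a" "adjoint P' b"] by (simp_all add: adj)
  have cross: "(LINT p|M. (a \<bullet> P (Xc p)) * (b \<bullet> P' (Xc p))) = 0" for a b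
  proof -
    have i1: "integrable M (\<lambda>p. a \<bullet> P (Xc p))" and i2: "integrable M (\<lambda>p. b \<bullet> P' (Xc p))"
      using integrable_bounded_linear[OF bl(1) Xc_int] integrable_bounded_linear[OF bl(2) Xc_int] by auto
    have "indep_var borel ((\<lambda>z. a \<bullet> (z - P (integral\<^sup>L M X))) \<circ> (\<lambda>p. P (X p)))
        borel ((\<lambda>z. b \<bullet> (z - P' (integral\<^sup>L M X))) \<circ> (\<lambda>p. P' (X p)))"
      using indep unfolding P_def P'_def by (rule indep_var_compose) measurable
    then have "indep_var borel (\<lambda>p. a \<bullet> P (Xc p)) borel (\<lambda>p. b \<bullet> P' (Xc p))"
      by (simp add: o_def Xc_def linear_diff[OF lin(1)] linear_diff[OF lin(2)])
    from indep_var_lebesgue_integral[OF this i1 i2]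
    have "(LINT p|M. (a \<bullet> P (Xc p)) * (b \<bullet> P' (Xc p))) =
        (LINT p|M. a \<bullet> P (Xc p)) * (LINT p|M. b \<bullet> P' (Xc p))" .
    also have "(LINT p|M. a \<bullet> P (Xc p)) = 0"
      using integral_bounded_linear[OF bounded_linear_compose[OF bounded_linear_inner_right[of a] bl(1)] Xc_int]
      by (simp add: Xc0 linear_0[OF lin(1)])
    finally show ?thesis by simp
  qed
  \<comment> \<open>The functional \<open>\<theta> - adjoint P \<theta>\<close> is \<theta> composed
    with \<open>P'\<close>. Dropping one vanishing cross term replaces \<open>a\<close> by
    \<open>adjoint P' a\<close>, and adding another restores \<theta>. What remains is
    \<open>adjoint P' a\<close> paired with \<open>w\<close>, which is zero as
    \<open>P' w = 0\<close>.\<close>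
  have "a \<bullet> (covariance M X *v (\<theta> - adjoint P \<theta>)) = 0" for a
  proof -
    have \<theta>P': "(\<theta> - adjoint P \<theta>) \<bullet> x = \<theta> \<bullet> P' x" for x
      using split[of \<theta> x] by (simp add: inner_diff_left adj)
    have "a \<bullet> (covariance M X *v (\<theta> - adjoint P \<theta>)) =
        (LINT p|M. (a \<bullet> P (Xc p)) * (\<theta> \<bullet> P' (Xc p)) + (a \<bullet> P' (Xc p)) * (\<theta> \<bullet> P' (Xc p)))"
      unfolding B(2) \<theta>P' by (simp only: split[of a "Xc _"] distrib_right)
    also have "\<dots> = (LINT p|M. (a \<bullet> P' (Xc p)) * (\<theta> \<bullet> P' (Xc p)))"
      using int by (simp add: cross)
    also have "\<dots> = (LINT p|M. (\<theta> \<bullet> P (Xc p)) * (a \<bullet> P' (Xc p)) + (a \<bullet> P' (Xc p)) * (\<theta> \<bullet> P' (Xc p)))"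
      using int by (simp add: cross)
    also have "\<dots> = (LINT p|M. (adjoint P' a \<bullet> Xc p) * (\<theta> \<bullet> Xc p))"
      by (simp only: adj split[of \<theta> "Xc _"] distrib_left mult.commute)
    also have "\<dots> = adjoint P' a \<bullet> (covariance M X *v \<theta>)" by (simp add: B(2))
    also have "\<dots> = 0" by (simp add: \<theta> adj Pw)
    finally show ?thesis .
  qed
  then have "form_sq (covariance M X) (\<theta> - adjoint P \<theta>) = 0" by (simp add: form_sq_def)
  then have "\<theta> - adjoint P \<theta> = 0" using cov_pos by fastforce
  then have \<theta>P: "\<theta> \<bullet> P x = \<theta> \<bullet> x" for x
    using adj(1)[of \<theta> x] by simp
  have P'0: "\<theta> \<bullet> P' x = 0" for x
    using \<theta>P[of x] split[of \<theta> x] by simp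
  then show "\<theta> \<bullet> component W' W x = 0" by (simp add: P'_def)
  have Z: "integrable M (\<lambda>p. P (X p))" using integrable_bounded_linear[OF bl(1) X(1)] .
  obtain K where K: "\<And>x. norm (P x) \<le> norm x * K"
    using bounded_linear.bounded[OF bl(1)] by blast
  have Z2: "integrable M (\<lambda>p. (norm (P (X p)))\<^sup>2)"
  proof (rule Bochner_Integration.integrable_bound)
    show "integrable M (\<lambda>p. K\<^sup>2 * (norm (X p))\<^sup>2)" using X(2) by simp
    have "(norm (P (X p)))\<^sup>2 \<le> K\<^sup>2 * (norm (X p))\<^sup>2" for p
      using power_mono[OF K[of "X p"] norm_ge_zero, of 2] by (simp add: power_mult_distrib mult.commute)
    then show "AE p in M. norm ((norm (P (X p)))\<^sup>2) \<le> norm (K\<^sup>2 * (norm (X p))\<^sup>2)" by simp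
  qed (use Z in auto)
  show "integrable M (\<lambda>p. component W W' (X p))" "integrable M (\<lambda>p. (norm (component W W' (X p)))\<^sup>2)"
    using Z Z2 by (simp_all add: P_def)
  have "\<eta> \<bullet> (covariance M (\<lambda>p. P (X p)) *v \<theta>) = (LINT p|M. (\<eta> \<bullet> P (Xc p)) * (\<theta> \<bullet> P (Xc p)))"
    unfolding inner_covariance(2)[OF M Z Z2] integral_bounded_linear[OF bl(1) X(1)]
    by (simp add: Xc_def linear_diff[OF lin(1)])
  also have "\<dots> = adjoint P \<eta> \<bullet> (covariance M X *v \<theta>)"
    by (simp add: B(2) adj \<theta>P)
  also have "\<dots> = \<eta> \<bullet> w" by (simp add: \<theta> adj Pw)
  finally show "\<eta> \<bullet> (covariance M (\<lambda>p. component W W' (X p)) *v \<theta>) = \<eta> \<bullet> w"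
    by (simp add: P_def)
qed

text \<open>Passes from the Fourier convention with 2 pi to the convention of characteristic
  functions, and moves \<open>U\<close> to the functional.\<close>

lemma wave_matrix_vector_mult:
  "wave \<omega> (U *v x) = iexp (((2 * pi) *\<^sub>R (transpose U *v \<omega>)) \<bullet> x)"
  unfolding inner_scaleR_left inner_matrix_vector_transpose[of \<omega> U x] by (simp add: ac_simps)

text \<open>The exponential of a sum splits over the two components; the factor \<open>h\<close>
  goes with the component in \<open>W'\<close>.\<close>

lemma integral_iexp_independent_components:
  fixes X :: "'a \<Rightarrow> real ^ 'n" and h :: "real ^ 'n \<Rightarrow> complex"
  assumes M: "prob_space M" and X[measurable]: "X \<in> borel_measurable M"
    and d: "direct_sum_decomp W W'"
    and indep: "prob_space.indep_var M borel (\<lambda>p. component W W' (X p))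
                  borel (\<lambda>p. component W' W (X p))"
    and h[measurable]: "h \<in> borel_measurable borel" "integrable M (\<lambda>p. h (component W' W (X p)))"
  shows "(LINT p|M. h (component W' W (X p)) * iexp (\<eta> \<bullet> X p)) =
    (LINT p|M. h (component W' W (X p)) * iexp (\<eta> \<bullet> component W' W (X p))) *
    (LINT p|M. iexp (\<eta> \<bullet> component W W' (X p)))"
proof -
  interpret prob_space M by fact
  define P P' where "P = component W W'" and "P' = component W' W"
  have "linear P" "linear P'"
    unfolding P_def P'_def using d direct_sum_decomp_commute linear_component by blast+
  then have [measurable]: "P \<in> borel_measurable borel" "P' \<in> borel_measurable borel"
    by (simp_all add: borel_measurable_continuous_onI linear_continuous_on linear_conv_bounded_linear)
  have [measurable]: "(\<lambda>p. h (P' (X p))) \<in> borel_measurable M" by measurable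
  have i1: "integrable M (\<lambda>p. iexp (\<eta> \<bullet> P (X p)))"
    by (intro integrable_const_bound[of _ 1]) auto
  have i2: "integrable M (\<lambda>p. h (P' (X p)) * iexp (\<eta> \<bullet> P' (X p)))"
    using h(2)[folded P'_def]
    by (rule Bochner_Integration.integrable_bound) (auto simp: norm_mult)
  have "indep_var borel ((\<lambda>z. iexp (\<eta> \<bullet> z)) \<circ> (\<lambda>p. P (X p)))
      borel ((\<lambda>z. h z * iexp (\<eta> \<bullet> z)) \<circ> (\<lambda>p. P' (X p)))"
    using indep unfolding P_def P'_def by (rule indep_var_compose) measurable
  from indep_var_lebesgue_integral[OF this[unfolded o_def] i1 i2]
  have "(LINT p|M. iexp (\<eta> \<bullet> P (X p)) * (h (P' (X p)) * iexp (\<eta> \<bullet> P' (X p)))) =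
    (LINT p|M. iexp (\<eta> \<bullet> P (X p))) * (LINT p|M. h (P' (X p)) * iexp (\<eta> \<bullet> P' (X p)))" .
  moreover have eq: "iexp (\<eta> \<bullet> P x) * (h (P' x) * iexp (\<eta> \<bullet> P' x)) = h (P' x) * iexp (\<eta> \<bullet> x)" for x
  proof -
    have "\<eta> \<bullet> x = \<eta> \<bullet> P x + \<eta> \<bullet> P' x"
      using component_add[OF d, of x] by (metis P_def P'_def inner_add_right)
    then show ?thesis by (simp add: distrib_left exp_add)
  qed
  ultimately show ?thesis unfolding eq by (simp only: P_def P'_def mult.commute)
qed

text \<open>The conjugate of the test wave is again a bounded function of \<open>X\<close>, so
  \<open>Y\<close> may be replaced by its conditional expectation; conjugating the identity moves
  the conjugate onto \<open>Y\<close>.\<close>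

lemma integral_cnj_iexp_cond:
  fixes X :: "'a \<Rightarrow> real ^ 'n" and g :: "'a \<Rightarrow> complex"
  assumes M: "prob_space M" and X[measurable]: "X \<in> borel_measurable M" and Y: "integrable M Y"
    and [measurable]: "g \<in> borel_measurable M"
    and ae: "AE p in M. complex_cond_exp M (vimage_algebra (space M) X borel) Y p = g p"
  shows "integrable M g"
    and "(LINT p|M. cnj (Y p) * iexp (\<eta> \<bullet> X p)) = (LINT p|M. cnj (g p) * iexp (\<eta> \<bullet> X p))"
proof -
  define \<phi> where "\<phi> x = iexp (- (\<eta> \<bullet> x))" for x
  have [measurable]: "\<phi> \<in> borel_measurable borel" unfolding \<phi>_def by measurable
  have \<phi>1: "norm (\<phi> x) \<le> 1" for x by (simp add: \<phi>_def norm_exp_eq_Re)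
  note ce = complex_cond_exp_integral[OF M X Y \<open>\<phi> \<in> borel_measurable borel\<close> \<phi>1]
  have meas: "complex_cond_exp M (vimage_algebra (space M) X borel) Y \<in> borel_measurable M"
    using ce(1) by auto
  note meas[measurable]
  show "integrable M g"
    using integrable_cong_AE[OF meas _ ae] ce(1) by simp
  have "(LINT p|M. Y p * \<phi> (X p)) = (LINT p|M. g p * \<phi> (X p))"
    by (subst ce(2)) (auto intro!: integral_cong_AE intro: eventually_mono[OF ae])
  then have "cnj (LINT p|M. Y p * \<phi> (X p)) = cnj (LINT p|M. g p * \<phi> (X p))" by simp
  then show "(LINT p|M. cnj (Y p) * iexp (\<eta> \<bullet> X p)) = (LINT p|M. cnj (g p) * iexp (\<eta> \<bullet> X p))"
    unfolding Bochner_Integration.integral_cnj[symmetric] by (simp add: \<phi>_def exp_cnj)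
qed

text \<open>As \<open>\<theta> \<bullet> w = 1\<close>, the map \<open>A\<close> multiplies the
  coordinate \<open>\<theta> \<bullet> X p\<close> by \<open>1 + s\<close>. This coordinate is
  Gaussian with variance 1, so independent noise along \<open>U *v w\<close> can restore its law,
  and \<open>J_lin_noise_removal\<close> applies.\<close>

lemma J_lin_shrink_gaussian_direction:
  fixes X :: "'a \<Rightarrow> real ^ 'n" and k :: "real ^ 'n \<Rightarrow> real" and U A :: "real ^ 'n ^ 'n"
  assumes M: "prob_space M" and X[measurable]: "X \<in> borel_measurable M"
    and X1: "integrable M X" and X2: "integrable M (\<lambda>p. (norm (X p))\<^sup>2)"
    and Y: "Y \<in> borel_measurable M" "integrable M (\<lambda>p. (cmod (Y p))\<^sup>2)"
    and k: "\<And>\<omega>. k \<omega> > 0" "integrable lborel k" and lam: "lam > 0"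
    and cov_pos: "\<And>\<omega>. \<omega> \<noteq> 0 \<Longrightarrow> form_sq (covariance M X) \<omega> > 0"
    and d: "direct_sum_decomp W W'"
    and gauss: "gaussian_vector M (\<lambda>p. component W W' (X p))
                  (LINT p|M. component W W' (X p))
                  (covariance M (\<lambda>p. component W W' (X p)))"
    and indep: "prob_space.indep_var M borel (\<lambda>p. component W W' (X p))
                  borel (\<lambda>p. component W' W (X p))"
    and cond: "\<exists>g :: real ^ 'n \<Rightarrow> complex. g \<in> borel_measurable borel \<and>
                 (AE p in M. complex_cond_exp M (vimage_algebra (space M) X borel) Y p
                    = g (component W' W (X p)))"
    and w: "w \<in> W" and \<theta>: "covariance M X *v \<theta> = w" "\<theta> \<bullet> w = 1"
    and s: "-1 \<le> s" "s \<le> 0"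
    and A: "\<And>x. A *v x = x + (s * (\<theta> \<bullet> x)) *\<^sub>R w"
  shows "J_lin M X Y k lam (U ** A) \<le> J_lin M X Y k lam U"
proof -
  interpret prob_space M by fact
  define Z Z' where "Z p = component W W' (X p)" and "Z' p = component W' W (X p)" for p
  define m Q where "m = integral\<^sup>L M Z" and "Q = covariance M Z"
  note cov = covariance_independent_components[OF M X1 X2 cov_pos d indep w \<theta>(1)]
  have \<theta>0: "\<theta> \<bullet> Z' p = 0" for p using cov(1) by (simp add: Z'_def)
  have Q\<theta>: "\<eta> \<bullet> (Q *v \<theta>) = \<eta> \<bullet> w" for \<eta> using cov(2) by (simp add: Q_def Z_def[abs_def])
  have Qnn: "0 \<le> form_sq Q \<eta>" for \<eta>
    unfolding Q_def Z_def[abs_def] by (rule form_sq_covariance_nonneg[OF M cov(3,4)])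
  have charZ: "(LINT p|M. iexp (\<eta> \<bullet> Z p)) = iexp (\<eta> \<bullet> m) * of_real (exp (- form_sq Q \<eta> / 2))" for \<eta>
    using gauss gaussian_vector_char[OF M _ Qnn] by (simp add: m_def Q_def Z_def[abs_def])
  \<comment> \<open>The variance lost by the coordinate is \<open>1 - (1 + s)\<^sup>2\<close>, which
    is nonnegative in the given range of \<open>s\<close>.\<close>
  define c where "c = sqrt (- (2 * s + s\<^sup>2))"
  have "0 \<le> - s * (2 + s)" using s by (intro mult_nonneg_nonneg) auto
  then have c: "c\<^sup>2 = - (2 * s + s\<^sup>2)" by (simp add: c_def power2_eq_square algebra_simps)
  \<comment> \<open>Shrinking also multiplies the mean of the coordinate by \<open>1 + s\<close>;
    the constant shift compensates for this.\<close>
  define \<tau> where "\<tau> u = c * u - s * (\<theta> \<bullet> m)" for u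
  define v where "v u = \<tau> u *\<^sub>R (U *v w)" for u
  define \<eta> where "\<eta> \<omega> = (2 * pi) *\<^sub>R (transpose U *v \<omega>)" for \<omega>
  \<comment> \<open>The pullback of the functional \<open>\<eta> \<omega>\<close> along
    \<open>A\<close>.\<close>
  define \<eta>' where "\<eta>' \<omega> = \<eta> \<omega> + (s * (\<eta> \<omega> \<bullet> w)) *\<^sub>R \<theta>" for \<omega>
  have waveU: "wave \<omega> (U *v x) = iexp (\<eta> \<omega> \<bullet> x)" for \<omega> x
    by (simp only: wave_matrix_vector_mult \<eta>_def)
  have waveUA: "wave \<omega> ((U ** A) *v x) = iexp (\<eta>' \<omega> \<bullet> x)" for \<omega> x
    unfolding matrix_vector_mul_assoc[symmetric] waveU A \<eta>'_def
    by (simp add: inner_add_left inner_add_right ac_simps)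
  have wavev: "(LINT u|std_normal_distribution. wave \<omega> (v u)) =
      iexp (- s * (\<theta> \<bullet> m) * (\<eta> \<omega> \<bullet> w)) * of_real (exp (- (c * (\<eta> \<omega> \<bullet> w))\<^sup>2 / 2))" for \<omega>
  proof -
    have "wave \<omega> (v u) = iexp (- s * (\<theta> \<bullet> m) * (\<eta> \<omega> \<bullet> w)) * iexp ((c * (\<eta> \<omega> \<bullet> w)) * u)" for u
    proof -
      have vU: "v u = U *v (\<tau> u *\<^sub>R w)" by (simp add: v_def matrix_vector_mult_scaleR)
      show ?thesis
        unfolding vU waveU by (simp add: \<tau>_def algebra_simps flip: exp_add)
    qed
    then show ?thesis by (simp only: integral_mult_right_zero integral_std_normal_iexp)
  qed
  \<comment> \<open>The identity for the Gaussian component alone: means and variances match because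
    \<open>Q\<close> sends \<theta> to \<open>w\<close> and gives it variance 1.\<close>
  have step: "(LINT p|M. iexp (\<eta> \<omega> \<bullet> Z p)) =
      (LINT p|M. iexp (\<eta>' \<omega> \<bullet> Z p)) * (LINT u|std_normal_distribution. wave \<omega> (v u))" for \<omega>
  proof -
    have "form_sq Q (\<eta>' \<omega>) = form_sq Q (\<eta> \<omega>) - (c * (\<eta> \<omega> \<bullet> w))\<^sup>2"
    proof -
      have "transpose Q = Q" by (simp add: Q_def transpose_covariance)
      then have "form_sq Q (\<eta>' \<omega>) = form_sq Q (\<eta> \<omega>) + 2 * (s * (\<eta> \<omega> \<bullet> w)) * (\<eta> \<omega> \<bullet> w)
          + (s * (\<eta> \<omega> \<bullet> w))\<^sup>2 * form_sq Q \<theta>"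
        unfolding \<eta>'_def by (simp add: form_sq_add_scaleR Q\<theta>)
      also have "form_sq Q \<theta> = 1" by (simp add: form_sq_def Q\<theta> \<theta>(2))
      finally show ?thesis
        unfolding power_mult_distrib c by (simp add: power2_eq_square algebra_simps)
    qed
    then have re: "exp (- form_sq Q (\<eta> \<omega>) / 2) =
        exp (- form_sq Q (\<eta>' \<omega>) / 2) * exp (- (c * (\<eta> \<omega> \<bullet> w))\<^sup>2 / 2)"
      by (simp add: diff_divide_distrib flip: exp_add)
    have im: "iexp (\<eta> \<omega> \<bullet> m) = iexp (\<eta>' \<omega> \<bullet> m) * iexp (- s * (\<theta> \<bullet> m) * (\<eta> \<omega> \<bullet> w))"
      by (simp add: \<eta>'_def inner_add_left algebra_simps flip: exp_add)
    show ?thesis unfolding charZ wavev re im by simp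
  qed
  \<comment> \<open>The shear leaves the component in \<open>W'\<close> unchanged, so by
    independence only the Gaussian factor is affected.\<close>
  have \<eta>Z': "\<eta>' \<omega> \<bullet> Z' p = \<eta> \<omega> \<bullet> Z' p" for \<omega> p
    by (simp add: \<eta>'_def inner_add_left \<theta>0)
  have factor: "(LINT p|M. h (Z' p) * iexp (\<eta> \<omega> \<bullet> X p)) =
      (LINT p|M. h (Z' p) * iexp (\<eta>' \<omega> \<bullet> X p)) * (LINT u|std_normal_distribution. wave \<omega> (v u))"
    if "h \<in> borel_measurable borel" "integrable M (\<lambda>p. h (Z' p))" for h :: "real ^ 'n \<Rightarrow> complex" and \<omega>
    using integral_iexp_independent_components[OF M X d indep that(1) that(2)[unfolded Z'_def]]
    by (simp add: Z_def[symmetric] Z'_def[symmetric] \<eta>Z' step)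
  obtain g :: "real ^ 'n \<Rightarrow> complex" where g[measurable]: "g \<in> borel_measurable borel"
    and ae: "AE p in M. complex_cond_exp M (vimage_algebra (space M) X borel) Y p
       = g (component W' W (X p))"
    using cond by blast
  have "linear (component W' W)" using linear_component[OF direct_sum_decomp_commute[OF d]] .
  then have [measurable]: "component W' W \<in> borel_measurable borel"
    by (simp add: borel_measurable_continuous_onI linear_continuous_on linear_conv_bounded_linear)
  have gm: "(\<lambda>p. g (component W' W (X p))) \<in> borel_measurable M" by measurable
  note ci = integral_cnj_iexp_cond[OF M X integrable_of_square[OF Y] gm ae]
  have v_meas: "v \<in> borel_measurable std_normal_distribution"
    unfolding v_def \<tau>_def by simp
  show ?thesis
  proof (rule J_lin_noise_removal[OF k lam M X Y _ v_meas])
    show "prob_space std_normal_distribution" by (rule prob_space_normal_density) simp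
    fix \<omega>
    show "(LINT p|M. wave \<omega> (U *v X p)) =
      (LINT p|M. wave \<omega> ((U ** A) *v X p)) * (LINT u|std_normal_distribution. wave \<omega> (v u))"
    proof -
      have "(LINT p|M. 1 * iexp (\<eta> \<omega> \<bullet> X p)) =
          (LINT p|M. 1 * iexp (\<eta>' \<omega> \<bullet> X p)) * (LINT u|std_normal_distribution. wave \<omega> (v u))"
        by (rule factor[of "\<lambda>_. 1"]) simp_all
      then show ?thesis unfolding waveU waveUA mult_1_left .
    qed
    show "(LINT p|M. cnj (Y p) * wave \<omega> (U *v X p)) =
      (LINT p|M. cnj (Y p) * wave \<omega> ((U ** A) *v X p)) * (LINT u|std_normal_distribution. wave \<omega> (v u))"
      unfolding waveU waveUA ci(2) Z'_def[symmetric]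
    proof (rule factor[of "\<lambda>z. cnj (g z)"])
      show "(\<lambda>z. cnj (g z)) \<in> borel_measurable borel" by measurable
      show "integrable M (\<lambda>p. cnj (g (Z' p)))" using ci(1) unfolding Z'_def by simp
    qed
  qed
qed

section \<open>The gradient flow\<close>

definition outer :: "real ^ 'n \<Rightarrow> real ^ 'n \<Rightarrow> real ^ 'n ^ 'n" where
  "outer a b = (\<chi> i j. a $ i * b $ j)"

lemma outer_vector_mult: "outer a b *v x = (b \<bullet> x) *\<^sub>R a"
  by (simp add: outer_def vec_eq_iff matrix_vector_mult_def inner_vec_def sum_distrib_left ac_simps)

lemma transpose_outer: "transpose (outer a b) = outer b a"
  by (simp add: outer_def transpose_def vec_eq_iff)

lemma contraction_outer:
  "(\<Sum>i\<in>UNIV. \<Sum>j\<in>UNIV. D $ i $ j * outer a b $ i $ j) = a \<bullet> (D *v b)"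
  by (simp add: outer_def inner_vec_def matrix_vector_mult_def sum_distrib_left ac_simps)

lemma symmetric_matrix_inv:
  fixes C :: "real ^ 'n ^ 'n"
  assumes "transpose C = C" "\<And>\<omega>. \<omega> \<noteq> 0 \<Longrightarrow> form_sq C \<omega> > 0"
  shows "transpose (matrix_inv C) = matrix_inv C"
proof -
  have 1: "C ** matrix_inv C = mat 1" by (rule pos_def_invertible[OF assms(2)])
  have 2: "transpose (matrix_inv C) ** C = mat 1"
    using arg_cong[OF 1, of transpose] unfolding matrix_transpose_mul assms(1) transpose_mat .
  have "transpose (matrix_inv C) ** (C ** matrix_inv C) = matrix_inv C"
    unfolding matrix_mul_assoc 2 by simp
  then show ?thesis unfolding 1 by simp
qed

lemma flow_field_eq:
  "flow_field G D S = (- 1 / 2) *\<^sub>R (S ** D S ** transpose G + G ** D S ** transpose S)"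
proof -
  have "(S ** D S ** transpose G) $ a $ b = (\<Sum>c\<in>UNIV. \<Sum>d\<in>UNIV. S $ a $ c * G $ b $ d * D S $ c $ d)" for a b
    unfolding matrix_matrix_mult_def transpose_def
    by (simp add: sum_distrib_right) (subst sum.swap, simp add: ac_simps)
  moreover have "(G ** D S ** transpose S) $ a $ b = (\<Sum>c\<in>UNIV. \<Sum>d\<in>UNIV. S $ b $ d * G $ a $ c * D S $ c $ d)" for a b
    unfolding matrix_matrix_mult_def transpose_def
    by (simp add: sum_distrib_right) (subst sum.swap, simp add: ac_simps)
  ultimately show ?thesis
    unfolding flow_field_def by (simp add: vec_eq_iff)
qed

text \<open>On the diagonal the two terms of the field are transposes of each other, hence equal,
  and the factor one half disappears.\<close>

lemma form_sq_flow_field: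
  assumes "transpose G = G" "transpose S = S" "transpose (D S) = D S"
  shows "form_sq (flow_field G D S) w = - ((S *v w) \<bullet> (D S *v (G *v w)))"
proof -
  have 1: "w \<bullet> ((S ** D S ** G) *v w) = (S *v w) \<bullet> (D S *v (G *v w))"
    unfolding matrix_vector_mul_assoc[symmetric]
    by (subst inner_matrix_vector_transpose) (simp only: assms)
  have "w \<bullet> ((G ** D S ** S) *v w) = (G *v w) \<bullet> (D S *v (S *v w))"
    unfolding matrix_vector_mul_assoc[symmetric]
    by (subst inner_matrix_vector_transpose) (simp only: assms)
  also have "\<dots> = (S *v w) \<bullet> (D S *v (G *v w))"
    by (rule symmetric_matrix_inner_commute[OF assms(3)])
  finally show ?thesis
    unfolding form_sq_def flow_field_eq assms(1,2) using 1
    by (simp only: scaleR_matrix_vector_assoc[symmetric] matrix_vector_mult_add_rdistrib inner_add_right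
        inner_scaleR_right) simp
qed

text \<open>The curve is \<open>s \<mapsto> A\<^sup>T S A\<close> with \<open>A x = x + s \<langle>\<theta>, x\<rangle> w\<close>; its velocity at
  \<open>s = 0\<close> is the direction against which the flow pairs \<open>D S\<close>.\<close>
lemma C1_derivative_along_shear_nonneg:
  fixes S :: "real ^ 'n ^ 'n"
  assumes D: "C1_derivative_on_Sym2_nonneg F D" and S: "S \<in> Sym2_nonneg"
    and mono: "\<And>s S'. \<lbrakk>-1 \<le> s; s \<le> 0; S' \<in> Sym2_nonneg;
      \<And>x. form_sq S' x = form_sq S (x + (s * (\<theta> \<bullet> x)) *\<^sub>R w)\<rbrakk> \<Longrightarrow> F S' \<le> F S"
  shows "0 \<le> (S *v w) \<bullet> (D S *v \<theta>)"
proof -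
  have sym: "transpose S = S" using S by (simp add: Sym2_nonneg_def)
  define z where "z = S *v w"
  define H where "H = outer \<theta> z + outer z \<theta>"
  \<comment> \<open>The pulled back form expanded in powers of \<open>s\<close>; \<open>H\<close> is
    its velocity at 0.\<close>
  define \<gamma> where "\<gamma> s = S + s *\<^sub>R H + (s\<^sup>2 * (w \<bullet> z)) *\<^sub>R outer \<theta> \<theta>" for s
  have form: "form_sq (\<gamma> s) x = form_sq S (x + (s * (\<theta> \<bullet> x)) *\<^sub>R w)" for s x
  proof -
    have "x \<bullet> (\<gamma> s *v x) = x \<bullet> (S *v x) + 2 * s * (\<theta> \<bullet> x) * (z \<bullet> x) + s\<^sup>2 * (w \<bullet> z) * (\<theta> \<bullet> x)\<^sup>2"
      by (simp add: \<gamma>_def H_def matrix_vector_mult_add_rdistrib scaleR_matrix_vector_assoc[symmetric]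
          outer_vector_mult inner_add_right inner_commute power2_eq_square algebra_simps)
    then show ?thesis
      unfolding form_sq_add_scaleR[OF sym]
      by (simp add: form_sq_def z_def[symmetric] inner_commute power2_eq_square algebra_simps)
  qed
  have \<gamma>_in: "\<gamma> s \<in> Sym2_nonneg" for s
  proof -
    have t: "transpose (A + B) = transpose A + transpose B" "transpose (c *\<^sub>R A) = c *\<^sub>R transpose A"
      for A B :: "real ^ 'n ^ 'n" and c by (simp_all add: transpose_def vec_eq_iff)
    have "transpose (\<gamma> s) = \<gamma> s"
      by (simp add: \<gamma>_def H_def t transpose_outer sym add.commute)
    then show ?thesis
      using S form by (simp add: Sym2_nonneg_def)
  qed
  have \<gamma>0: "\<gamma> 0 = S" by (simp add: \<gamma>_def)
  have "(\<gamma> has_vector_derivative H) (at 0 within {-1..0})"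
    unfolding \<gamma>_def by (auto intro!: derivative_eq_intros)
  then have d\<gamma>: "(\<gamma> has_derivative (\<lambda>h. h *\<^sub>R H)) (at 0 within {-1..0})"
    by (simp add: has_vector_derivative_def)
  define L where "L H = (\<Sum>c\<in>UNIV. \<Sum>d\<in>UNIV. D S $ c $ d * H $ c $ d)" for H :: "real ^ 'n ^ 'n"
  have symD: "transpose (D S) = D S" and dF: "(F has_derivative L) (at S within Sym2_nonneg)"
    using D S by (auto simp: C1_derivative_on_Sym2_nonneg_def L_def[abs_def])
  \<comment> \<open>The derivative of \<open>F\<close> is relative to the nonnegative forms; the
    curve stays among them, so the chain rule applies along it.\<close>
  have "(F has_derivative L) (at (\<gamma> 0) within \<gamma> ` {-1..0})"
    using dF \<gamma>_in unfolding \<gamma>0 by (auto intro: has_derivative_subset)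
  from diff_chain_within[OF d\<gamma> this]
  have "((\<lambda>s. F (\<gamma> s)) has_derivative (\<lambda>h. L (h *\<^sub>R H))) (at 0 within {-1..0})"
    by (simp add: o_def)
  moreover have "L (h *\<^sub>R H) = L H * h" for h
    by (simp add: L_def sum_distrib_left sum_distrib_right ac_simps)
  ultimately have deriv: "((\<lambda>s. F (\<gamma> s)) has_real_derivative L H) (at 0 within {-1..0})"
    by (simp add: has_field_derivative_def)
  \<comment> \<open>A negative left derivative at 0 would make \<open>F\<close> exceed
    \<open>F S\<close> at small negative parameters, against \<open>mono\<close>.\<close>
  have "0 \<le> L H"
  proof (rule ccontr)
    assume "\<not> 0 \<le> L H"
    then obtain \<epsilon> where \<epsilon>: "\<epsilon> > 0" "\<And>h. 0 < h \<Longrightarrow> 0 - h \<in> {-1..0} \<Longrightarrow> h < \<epsilon> \<Longrightarrow> F (\<gamma> 0) < F (\<gamma> (0 - h))"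
      using has_real_derivative_neg_dec_left[OF deriv] by auto
    define h where "h = min 1 (\<epsilon> / 2)"
    have h: "0 < h" "h \<le> 1" "h < \<epsilon>" using \<epsilon>(1) by (auto simp: h_def)
    have "F (\<gamma> (- h)) \<le> F S"
      using h by (intro mono[of "- h"] \<gamma>_in form) auto
    then show False using \<epsilon>(2)[of h] h by (simp add: \<gamma>0)
  qed
  also have "L H = \<theta> \<bullet> (D S *v z) + z \<bullet> (D S *v \<theta>)"
    unfolding L_def H_def contraction_outer[symmetric] by (simp add: distrib_left sum.distrib)
  also have "\<dots> = 2 * (z \<bullet> (D S *v \<theta>))"
    using symmetric_matrix_inner_commute[OF symD, of \<theta> z] by simp
  finally show ?thesis by (simp add: z_def)
qed

lemma integrable_norm_power_le:
  fixes X :: "'a \<Rightarrow> 'b::{second_countable_topology, banach}"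
  assumes "prob_space M" and [measurable]: "X \<in> borel_measurable M"
    and "integrable M (\<lambda>p. norm (X p) ^ n)" "m \<le> n"
  shows "integrable M (\<lambda>p. norm (X p) ^ m)"
proof -
  interpret prob_space M by fact
  show ?thesis
  proof (rule Bochner_Integration.integrable_bound)
    show "integrable M (\<lambda>p. 1 + norm (X p) ^ n)" using assms(3) by simp
    have "norm (X p) ^ m \<le> 1 + norm (X p) ^ n" for p
    proof (cases "norm (X p) \<le> 1")
      case True
      then have "norm (X p) ^ m \<le> 1" by (simp add: power_le_one)
      moreover have "0 \<le> norm (X p) ^ n" by simp
      ultimately show ?thesis by linarith
    next
      case False
      then have "norm (X p) ^ m \<le> norm (X p) ^ n" using assms(4) by (intro power_increasing) auto
      then show ?thesis by linarith
    qed
    then show "AE p in M. norm (norm (X p) ^ m) \<le> norm (1 + norm (X p) ^ n)" by simp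
  qed simp
qed

theorem theorem1p4:
  fixes M :: "'a measure"
    and X :: "'a \<Rightarrow> real ^ 'n"
    and Y :: "'a \<Rightarrow> complex"
    and lam :: real
    and k :: "real ^ 'n \<Rightarrow> real"
    and Kc K1 K2 :: "real \<Rightarrow> real"
    and W W' :: "(real ^ 'n) set"
    and DJ :: "real ^ 'n ^ 'n \<Rightarrow> real ^ 'n ^ 'n"
    and \<Sigma> :: "real \<Rightarrow> real ^ 'n ^ 'n"
    and w :: "real ^ 'n"
  assumes "prob_space M"
    and "X \<in> borel_measurable M" and "Y \<in> borel_measurable M"
    and "lam > 0"
    and "integrable M (\<lambda>p. (cmod (Y p))\<^sup>2)"
    and "integrable M (\<lambda>p. norm (X p) ^ 8)"
    and cov_pos: "\<And>\<omega>. \<omega> \<noteq> 0 \<Longrightarrow> form_sq (covariance M X) \<omega> > 0"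
    and k_pos: "\<And>\<omega>. k \<omega> > 0"
    and k_rot: "\<exists>\<kappa>. \<forall>\<omega>. k \<omega> = \<kappa> (form_sq (covariance M X) \<omega>)"
    and k_int: "has_bochner_integral lborel k 1"
    and K_rot: "\<And>x. kernel_of k x = of_real (Kc (form_sq (V_form M X) x))"
    and K_deriv1: "\<And>r. r \<ge> 0 \<Longrightarrow> (Kc has_real_derivative K1 r) (at r within {0..})"
    and K_deriv2: "\<And>r. r \<ge> 0 \<Longrightarrow> (K1 has_real_derivative K2 r) (at r within {0..})"
    and "continuous_on {0..} K1" and "bounded (K1 ` {0..})"
    and "continuous_on {0..} K2" and "bounded (K2 ` {0..})"
    and K_decay: "\<exists>R B. \<forall>r\<ge>R. \<bar>r * K1 r\<bar> \<le> B"
    and decomp: "direct_sum_decomp W W'"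
    and gauss: "gaussian_vector M (\<lambda>p. component W W' (X p))
                  (LINT p|M. component W W' (X p))
                  (covariance M (\<lambda>p. component W W' (X p)))"
    and indep: "prob_space.indep_var M borel (\<lambda>p. component W W' (X p))
                  borel (\<lambda>p. component W' W (X p))"
    and cond: "\<exists>g :: real ^ 'n \<Rightarrow> complex. g \<in> borel_measurable borel \<and>
                 (AE p in M. complex_cond_exp M (vimage_algebra (space M) X borel) Y p
                    = g (component W' W (X p)))"
    and DJ: "C1_derivative_on_Sym2_nonneg (J_form M X Y k lam) DJ"
    and flow_in: "\<And>t. t \<ge> 0 \<Longrightarrow> \<Sigma> t \<in> Sym2_nonneg"
    and flow: "\<And>t. t \<ge> 0 \<Longrightarrow>
                 (\<Sigma> has_vector_derivative flow_field (V_form M X) DJ (\<Sigma> t)) (at t within {0..})"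
    and "w \<in> W" and "form_norm (V_form M X) w = 1"
  shows "antimono_on {0..} (\<lambda>t. form_norm (\<Sigma> t) w)"
proof -
  \<comment> \<open>The functional \<theta> is the metric dual of \<open>w\<close>; its value at
    \<open>w\<close> is the squared norm of \<open>w\<close>, which is 1.\<close>
  define C G \<theta> where "C = covariance M X" and "G = matrix_inv C" and "\<theta> = G *v w"
  have GV: "V_form M X = G" by (simp add: V_form_def G_def C_def)
  have C_sym: "transpose C = C" by (simp add: C_def transpose_covariance)
  have C_pos: "form_sq C \<omega> > 0" if "\<omega> \<noteq> 0" for \<omega> using cov_pos[OF that] by (simp add: C_def)
  have G_sym: "transpose G = G" unfolding G_def by (rule symmetric_matrix_inv[OF C_sym C_pos])
  have C\<theta>: "C *v \<theta> = w"
    using matrix_inverse_vector_mult(1)[OF pos_def_invertible[OF C_pos]] by (simp add: \<theta>_def G_def)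
  have \<theta>w: "\<theta> \<bullet> w = 1"
    using \<open>form_norm (V_form M X) w = 1\<close>
    by (simp add: GV form_norm_def form_sq_def \<theta>_def inner_commute)
  have X1: "integrable M X"
    using integrable_norm_power_le[OF assms(1,2,6), of 1] assms(2) by (simp add: integrable_norm_iff)
  have X2: "integrable M (\<lambda>p. (norm (X p))\<^sup>2)"
    using integrable_norm_power_le[OF assms(1,2,6), of 2] by simp
  have k_int': "integrable lborel k" using k_int by (rule integrable.intros)
  obtain \<kappa> where \<kappa>: "\<And>\<omega>. k \<omega> = \<kappa> (form_sq C \<omega>)" using k_rot by (auto simp: C_def)
  define root where "root S = (SOME U :: real ^ 'n ^ 'n. \<forall>x. form_sq S x = form_sq G (U *v x))"
    for S :: "real ^ 'n ^ 'n"
  have root: "form_sq S x = form_sq G (root S *v x)" if "S \<in> Sym2_nonneg" for S :: "real ^ 'n ^ 'n" and x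
  proof -
    have "\<exists>U. \<forall>x. form_sq S x = form_sq G (U *v x)"
      unfolding G_def by (rule Sym2_nonneg_form_root[OF C_sym C_pos that])
    from someI_ex[OF this] show ?thesis unfolding root_def by blast
  qed
  have J: "J_form M X Y k lam S = J_lin M X Y k lam (root S)" for S
    by (simp add: J_form_def root_def GV)
  have J_mono: "J_form M X Y k lam S' \<le> J_form M X Y k lam S"
    if S: "S \<in> Sym2_nonneg" and s: "-1 \<le> s" "s \<le> 0" and S': "S' \<in> Sym2_nonneg"
      and eq: "\<And>x. form_sq S' x = form_sq S (x + (s * (\<theta> \<bullet> x)) *\<^sub>R w)" for S S' s
  proof -
    define A where "A = mat 1 + s *\<^sub>R outer w \<theta>"
    have A: "A *v x = x + (s * (\<theta> \<bullet> x)) *\<^sub>R w" for x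
      by (simp add: A_def matrix_vector_mult_add_rdistrib scaleR_matrix_vector_assoc[symmetric] outer_vector_mult)
    \<comment> \<open>The chosen root of \<open>S'\<close> may differ from
      \<open>root S ** A\<close>, but both represent \<open>S'\<close>, so rotational invariance
      bridges the gap.\<close>
    have "J_lin M X Y k lam (root S') \<le> J_lin M X Y k lam (root S ** A)"
    proof (rule J_lin_isometry[where \<kappa> = \<kappa> and C = C, OF k_pos \<open>lam > 0\<close> C_sym C_pos \<kappa>])
      show "form_sq (matrix_inv C) (root S' *v x) = form_sq (matrix_inv C) ((root S ** A) *v x)" for x
        unfolding matrix_vector_mul_assoc[symmetric] A
        using root[OF S', of x] root[OF S, of "x + (s * (\<theta> \<bullet> x)) *\<^sub>R w"] eq[of x]
        by (simp add: G_def)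
    qed
    also have "\<dots> \<le> J_lin M X Y k lam (root S)"
      by (rule J_lin_shrink_gaussian_direction[OF assms(1,2) X1 X2 assms(3,5) k_pos k_int' \<open>lam > 0\<close>
            cov_pos decomp gauss indep cond \<open>w \<in> W\<close> C\<theta>[unfolded C_def] \<theta>w s A])
    finally show ?thesis by (simp add: J)
  qed
  define \<phi> where "\<phi> t = form_sq (\<Sigma> t) w" for t
  have deriv: "(\<phi> has_real_derivative - ((\<Sigma> t *v w) \<bullet> (DJ (\<Sigma> t) *v \<theta>))) (at t within {0..})"
    if t: "t \<ge> 0" for t
  proof -
    have "bounded_linear (\<lambda>S. form_sq S w)"
      unfolding form_sq_def linear_conv_bounded_linear[symmetric]
      by (rule linearI) (simp_all add: matrix_vector_mult_add_rdistrib inner_add_right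
          scaleR_matrix_vector_assoc[symmetric])
    from bounded_linear.has_vector_derivative[OF this flow[OF t]]
    have "(\<phi> has_vector_derivative form_sq (flow_field G DJ (\<Sigma> t)) w) (at t within {0..})"
      by (simp add: \<phi>_def[abs_def] GV)
    moreover have "form_sq (flow_field G DJ (\<Sigma> t)) w = - ((\<Sigma> t *v w) \<bullet> (DJ (\<Sigma> t) *v \<theta>))"
      unfolding \<theta>_def using flow_in[OF t] DJ G_sym
      by (intro form_sq_flow_field) (auto simp: Sym2_nonneg_def C1_derivative_on_Sym2_nonneg_def)
    ultimately show ?thesis by (simp add: has_real_derivative_iff_has_vector_derivative)
  qed
  have nonneg: "0 \<le> (\<Sigma> t *v w) \<bullet> (DJ (\<Sigma> t) *v \<theta>)" if t: "t \<ge> 0" for t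
    by (rule C1_derivative_along_shear_nonneg[OF DJ flow_in[OF t]]) (rule J_mono[OF flow_in[OF t]])
  \<comment> \<open>At time 0 only a one-sided derivative is given, so the sign of the derivative is
    used in the open interval together with continuity on the closed one.\<close>
  have "\<phi> b \<le> \<phi> a" if "0 \<le> a" "a \<le> b" for a b
  proof (rule DERIV_nonpos_imp_decreasing_open[OF \<open>a \<le> b\<close>])
    show "\<exists>y. (\<phi> has_real_derivative y) (at x) \<and> y \<le> 0" if x: "a < x" "x < b" for x
    proof -
      have "x \<in> interior {0..}" using x \<open>0 \<le> a\<close> by (simp add: interior_Ici[of "-1"])
      then have "at x within {0..} = at x" by (rule at_within_interior)
      then show ?thesis using deriv[of x] nonneg[of x] x \<open>0 \<le> a\<close> by auto
    qed
    show "continuous_on {a..b} \<phi>"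
      using deriv \<open>0 \<le> a\<close>
      by (intro continuous_on_subset[OF DERIV_continuous_on[of "{0..}"]]) auto
  qed
  then show ?thesis
    by (intro monotone_onI) (auto simp: form_norm_def \<phi>_def)
qed

end
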